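(* Let $q$ be a positive integer and $0<c\le1/q$. For a graphon $W\in\mathcal W_{[0,1]}$ define $$\tilde\mu_q^c(W)=\inf_{(S_1,\dots,S_q)\in\mathcal Q_q^c}\ \sum_{i=1}^{q-1}\sum_{j=i+1}^q\iint_{S_i\times S_j}\frac1{\lambda(S_i)\lambda(S_j)}\,W(x,y)\,dx\,dy ,$$ where $\mathcal Q_q^c$ is the set of $c$-balanced $q$-partitions of $[0,1]$, i.e. partitions of $[0,1]$ into Lebesgue-measurable sets $S_1,\dots,S_q$ with $\sum_{i=1}^q\lambda(S_i)=1$ and $\lambda(S_i)\ge c$ for all $i\in[q]$ ($\lambda$ denoting Lebesgue measure). Then $\tilde\mu_q^c$ is the extension of $\mu_q^c$ to graphons in the following sense: if $(G_n)$ is a convergent sequence of weighted graphs in $\mathcal G$ with uniformly bounded edge-weights and no dominant vertex-weights, i.e. $\max_i\alpha_i(G_n)/\alpha_{G_n}\to0$, and $W$ is the essentially unique limit graphon of the sequence, i.e. $\delta_\square(W_{G_n},W)\to0$, then $\mu_q^c(G_n)\to\tilde\mu_q^c(W)$ as $n\to\infty$.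
   Context: $\mathcal G$ is the set of all finite weighted graphs $G$ on vertex sets $V(G)=[n]=\{1,\dots,n\}$ with vertex-weights $\alpha_i=\alpha_i(G)>0$ and edge-weights $\beta_{ij}=\beta_{ji}\in[0,1]$ ($i,j\in[n]$; so edge-weights are automatically uniformly bounded). Put $\alpha_G=\sum_i\alpha_i$, $\alpha_T=\sum_{i\in T}\alpha_i$ for $T\subset V(G)$, and $e_G(S,T)=\sum_{s\in S}\sum_{t\in T}\alpha_s\alpha_t\beta_{st}$. $\mathcal P_q^c$ is the set of partitions $(V_1,\dots,V_q)$ of $V(G)$ into $q$ non-empty disjoint sets with $\alpha_{V_i}/\alpha_G\ge c$ for all $i\in[q]$, and the minimum weighted $c$-balanced $q$-way cut density of $G$ is $\mu_q^c(G)=\min_{(V_1,\dots,V_q)\in\mathcal P_q^c}\sum_{i=1}^{q-1}\sum_{j=i+1}^q\frac1{\alpha_{V_i}\alpha_{V_j}}e_G(V_i,V_j)$. Convergence: for a simple graph $F$ on $[k]$, $t(F,G)=\frac1{\alpha_G^k}\sum_{\Phi:[k]\to V(G)}\prod_{i=1}^k\alpha_{\Phi(i)}\prod_{ij\in E(F)}\beta_{\Phi(i)\Phi(j)}$; $(G_n)$ is convergent if $t(F,G_n)$ converges for every simple graph $F$. It is known that for a convergent sequence of weighted graphs with uniformly bounded edge-weights there is a graphon $W$, unique up to $\delta_\square$-distance zero, with $\delta_\square(W_{G_n},W)\to0$. Graphons: $\mathcal W_{[0,1]}$ is the set of symmetric measurable functions $W:[0,1]^2\to[0,1]$. The cut-norm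 is $\|W\|_\square=\sup_{S,T\subset[0,1]}|\iint_{S\times T}W\,dx\,dy|$ (sup over measurable sets), and $\delta_\square(W,U)=\inf_\nu\|W-U^\nu\|_\square$ over measure preserving bijections $\nu$ of $[0,1]$, where $U^\nu(x,y)=U(\nu(x),\nu(y))$. $W_G$ is the stepfunction obtained by dividing $[0,1]$ into consecutive intervals $I_1,\dots,I_n$ of lengths $\alpha_i/\alpha_G$ and setting $W_G=\beta_{ij}$ on $I_i\times I_j$.
   Formalization: For q ≥ 2 the formal statement requires c < 1/q instead of c ≤ 1/q: at c = 1/q balanced partitions of G_n may not exist, and even when they do the limit of the minima can differ from the graphon value (e.g. q = 2, c = 1/2). *)

theory Defs
  imports "HOL-Analysis.Analysis"
begin

record wgraph =
  nverts :: nat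
  vweight :: "nat \<Rightarrow> real"
  eweight :: "nat \<Rightarrow> nat \<Rightarrow> real"

definition verts :: "wgraph \<Rightarrow> nat set" where
  "verts G = {1..nverts G}"

text \<open>Loops are allowed: the weight of the pair \<open>(i, i)\<close> may be nonzero. Values of the
  weight functions outside the vertex set are irrelevant.\<close>

definition weighted_graph :: "wgraph \<Rightarrow> bool" where
  "weighted_graph G \<longleftrightarrow>
     nverts G \<ge> 1 \<and>
     (\<forall>i\<in>verts G. vweight G i > 0) \<and>
     (\<forall>i\<in>verts G. \<forall>j\<in>verts G.
        eweight G i j = eweight G j i \<and> 0 \<le> eweight G i j \<and> eweight G i j \<le> 1)"

definition set_weight :: "wgraph \<Rightarrow> nat set \<Rightarrow> real" where
  "set_weight G T = (\<Sum>i\<in>T. vweight G i)"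

definition total_weight :: "wgraph \<Rightarrow> real" where
  "total_weight G = set_weight G (verts G)"

definition cut_weight :: "wgraph \<Rightarrow> nat set \<Rightarrow> nat set \<Rightarrow> real" where
  "cut_weight G S T = (\<Sum>s\<in>S. \<Sum>t\<in>T. vweight G s * vweight G t * eweight G s t)"

text \<open>A \<open>q\<close>-partition is an indexed family on \<open>{1..q}\<close>; extensionality
  makes the set of these families finite.\<close>

definition balanced_partitions :: "nat \<Rightarrow> real \<Rightarrow> wgraph \<Rightarrow> (nat \<Rightarrow> nat set) set" where
  "balanced_partitions q c G =
     {V \<in> {1..q} \<rightarrow>\<^sub>E Pow (verts G).
        (\<forall>i\<in>{1..q}. V i \<noteq> {}) \<and>
        disjoint_family_on V {1..q} \<and>
        (\<Union>i\<in>{1..q}. V i) = verts G \<and>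
        (\<forall>i\<in>{1..q}. set_weight G (V i) / total_weight G \<ge> c)}"

text \<open>The value is unspecified when there is no \<open>c\<close>-balanced \<open>q\<close>-partition at all.\<close>

definition min_cut_density :: "nat \<Rightarrow> real \<Rightarrow> wgraph \<Rightarrow> real" where
  "min_cut_density q c G =
     Min ((\<lambda>V. \<Sum>i=1..q-1. \<Sum>j=i+1..q.
             1 / (set_weight G (V i) * set_weight G (V j)) * cut_weight G (V i) (V j))
          ` balanced_partitions q c G)"

text \<open>A simple graph on \<open>{1..k}\<close> is given by its edge set, each edge being listed once as
  the pair of its endpoints in increasing order.\<close>

definition simple_edges :: "nat \<Rightarrow> (nat \<times> nat) set \<Rightarrow> bool" where
  "simple_edges k E \<longleftrightarrow> E \<subseteq> {(i, j). 1 \<le> i \<and> i < j \<and> j \<le> k}"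

definition hom_density :: "nat \<Rightarrow> (nat \<times> nat) set \<Rightarrow> wgraph \<Rightarrow> real" where
  "hom_density k E G =
     1 / total_weight G ^ k *
     (\<Sum>\<Phi>\<in>{1..k} \<rightarrow>\<^sub>E verts G.
        (\<Prod>i=1..k. vweight G (\<Phi> i)) * (\<Prod>(i, j)\<in>E. eweight G (\<Phi> i) (\<Phi> j)))"

definition convergent_graphs :: "(nat \<Rightarrow> wgraph) \<Rightarrow> bool" where
  "convergent_graphs G \<longleftrightarrow>
     (\<forall>k E. simple_edges k E \<longrightarrow> convergent (\<lambda>n. hom_density k E (G n)))"

definition graphon :: "(real \<Rightarrow> real \<Rightarrow> real) \<Rightarrow> bool" where
  "graphon W \<longleftrightarrow>
     (\<lambda>(x, y). W x y) \<in> borel_measurable (lebesgue_on ({0..1} \<times> {0..1})) \<and>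
     (\<forall>x\<in>{0..1}. \<forall>y\<in>{0..1}. W x y = W y x \<and> 0 \<le> W x y \<and> W x y \<le> 1)"

definition unit_measurable_sets :: "real set set" where
  "unit_measurable_sets = {S. S \<in> sets lebesgue \<and> S \<subseteq> {0..1}}"

definition cut_norm :: "(real \<Rightarrow> real \<Rightarrow> real) \<Rightarrow> real" where
  "cut_norm W =
     (SUP (S, T) \<in> unit_measurable_sets \<times> unit_measurable_sets.
        \<bar>LINT (x, y) : S \<times> T | lebesgue. W x y\<bar>)"

text \<open>Measurability of the inverse is automatic for measure preserving bijections of
  \<open>[0,1]\<close>, so stating it does not change the set.\<close>

definition mp_bijections :: "(real \<Rightarrow> real) set" where
  "mp_bijections =
     {\<nu>. bij_betw \<nu> {0..1} {0..1} \<and>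
         \<nu> \<in> measurable (lebesgue_on {0..1}) (lebesgue_on {0..1}) \<and>
         inv_into {0..1} \<nu> \<in> measurable (lebesgue_on {0..1}) (lebesgue_on {0..1}) \<and>
         distr (lebesgue_on {0..1}) (lebesgue_on {0..1}) \<nu> = lebesgue_on {0..1}}"

definition cut_dist :: "(real \<Rightarrow> real \<Rightarrow> real) \<Rightarrow> (real \<Rightarrow> real \<Rightarrow> real) \<Rightarrow> real" where
  "cut_dist W U = (INF \<nu> \<in> mp_bijections. cut_norm (\<lambda>x y. W x y - U (\<nu> x) (\<nu> y)))"

text \<open>The consecutive intervals are taken closed on the right, and the first one also on the
  left, so that they partition \<open>[0,1]\<close> exactly.\<close>

definition step_end :: "wgraph \<Rightarrow> nat \<Rightarrow> real" where
  "step_end G i = set_weight G {1..i} / total_weight G"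

definition step_interval :: "wgraph \<Rightarrow> nat \<Rightarrow> real set" where
  "step_interval G i =
     (if i = 1 then {0..step_end G 1} else {step_end G (i - 1)<..step_end G i})"

definition step_graphon :: "wgraph \<Rightarrow> real \<Rightarrow> real \<Rightarrow> real" where
  "step_graphon G x y =
     (\<Sum>i\<in>verts G. \<Sum>j\<in>verts G.
        eweight G i j * indicator (step_interval G i) x * indicator (step_interval G j) y)"

definition unit_balanced_partitions :: "nat \<Rightarrow> real \<Rightarrow> (nat \<Rightarrow> real set) set" where
  "unit_balanced_partitions q c =
     {S. (\<forall>i\<in>{1..q}. S i \<in> sets lebesgue) \<and>
         disjoint_family_on S {1..q} \<and>
         (\<Union>i\<in>{1..q}. S i) = {0..1} \<and>
         (\<Sum>i=1..q. measure lebesgue (S i)) = 1 \<and>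
         (\<forall>i\<in>{1..q}. measure lebesgue (S i) \<ge> c)}"

definition graphon_cut_density :: "nat \<Rightarrow> real \<Rightarrow> (real \<Rightarrow> real \<Rightarrow> real) \<Rightarrow> real" where
  "graphon_cut_density q c W =
     (INF S \<in> unit_balanced_partitions q c.
        \<Sum>i=1..q-1. \<Sum>j=i+1..q.
          (LINT (x, y) : S i \<times> S j | lebesgue.
             1 / (measure lebesgue (S i) * measure lebesgue (S j)) * W x y))"

end

theory Submission
  imports Defs
begin

text \<open>The density of a fixed \<open>c\<close>-balanced partition changes by at most \<open>(q / c)\<^sup>2\<close> times the cut norm
  when the kernel changes, and measure preserving bijections permute the balanced partitions; hence
  the infimum over partitions of \<open>[0,1]\<close> is continuous in the cut distance, and it remains to compare
  the graph with its own step graphon. Vertex partitions are special partitions of \<open>[0,1]\<close>.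
  Conversely, a partition of \<open>[0,1]\<close> is a fractional vertex partition \<open>x\<close>. Consider the density with
  its denominators frozen, plus \<open>K\<close> times the sum of the squared deviations of the masses, with the
  diagonal terms altered so that the whole is affine in each row of \<open>x\<close>. Rows can then be
  rounded to unit vectors one at a time without increasing this quantity, and altering the
  diagonal costs at most \<open>K\<close> times the largest relative vertex weight.\<close>

subsection \<open>Measure preserving bijections act on the unit square\<close>

text \<open>The rounding is derandomized sampling. If every vertex \<open>u\<close> independently
  receives a label with distribution \<open>x u\<close>, the expected frozen density has no diagonal
  terms, since one vertex never carries two labels, and the expected squared deviation of a class
  mass is its squared bias plus a variance. The altered expressions are exactly these expectations;
  independence makes them affine in each row, and fixing labels one by one is the method of
  conditional expectations. The denominators are the obstacle: with the true class masses the
  density is not affine in a row. They are frozen at the masses of the starting point, and the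
  penalty keeps the rounded masses so close to these that the true denominators can be restored. It
  depends on \<open>q\<close>, \<open>c\<close> and the error alone, which makes the estimate
  uniform over all graphs.\<close>

lemma completion_restrict_space:
  assumes \<Omega>: "\<Omega> \<in> sets M"
  shows "completion (restrict_space M \<Omega>) = restrict_space (completion M) \<Omega>"
proof (rule measure_eqI)
  have sub: "\<Omega> \<inter> space M \<in> sets M" "\<Omega> \<inter> space (completion M) \<in> sets (completion M)"
    using \<Omega> by auto
  show eq: "sets (completion (restrict_space M \<Omega>)) = sets (restrict_space (completion M) \<Omega>)"
  proof (intro set_eqI iffI)
    fix A assume "A \<in> sets (completion (restrict_space M \<Omega>))"
    then obtain S N N' where *: "A = S \<union> N" "N \<subseteq> N'" "N' \<in> null_sets (restrict_space M \<Omega>)"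
        "S \<in> sets (restrict_space M \<Omega>)"
      by (rule sets_completionE)
    then have "N' \<in> null_sets M" "N' \<subseteq> \<Omega>" using null_sets_restrict_space[OF \<Omega>] by auto
    moreover have "S \<in> sets M" "S \<subseteq> \<Omega>" using * sets_restrict_space_iff[OF sub(1)] by auto
    ultimately show "A \<in> sets (restrict_space (completion M) \<Omega>)"
      using * sub(2) sets_completionI[of A S N N' M] by (auto simp: sets_restrict_space_iff)
  next
    fix A assume "A \<in> sets (restrict_space (completion M) \<Omega>)"
    then have A: "A \<subseteq> \<Omega>" "A \<in> sets (completion M)"
      using sets_restrict_space_iff[OF sub(2)] by auto
    from A(2) obtain S N N' where *: "A = S \<union> N" "N \<subseteq> N'" "N' \<in> null_sets M" "S \<in> sets M"
      by (rule sets_completionE)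
    \<comment> \<open>A null cover may be cut down to \<open>\<Omega>\<close> because
      \<open>\<Omega>\<close> is itself measurable.\<close>
    have "N' \<inter> \<Omega> \<in> null_sets (restrict_space M \<Omega>)"
      using * \<Omega> by (auto simp: null_sets_restrict_space intro: null_set_Int2)
    moreover have "S \<in> sets (restrict_space M \<Omega>)"
      using * A sub(1) by (auto simp: sets_restrict_space_iff)
    ultimately show "A \<in> sets (completion (restrict_space M \<Omega>))"
      using * A by (intro sets_completionI[of A S N "N' \<inter> \<Omega>"]) auto
  qed
  fix A assume A: "A \<in> sets (completion (restrict_space M \<Omega>))"
  then obtain S N N' where *: "A = S \<union> N" "N \<subseteq> N'" "N' \<in> null_sets (restrict_space M \<Omega>)"
      "S \<in> sets (restrict_space M \<Omega>)"
    by (rule sets_completionE)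
  have N'0: "N' \<in> null_sets M" and S: "S \<in> sets M" "S \<subseteq> \<Omega>"
    using * null_sets_restrict_space[OF \<Omega>] sets_restrict_space_iff[OF sub(1)] by auto
  have N: "N \<in> null_sets (completion (restrict_space M \<Omega>))" "N \<in> null_sets (completion M)"
    using * N'0 by (auto simp: null_sets_completion_iff2)
  have "emeasure (completion (restrict_space M \<Omega>)) A = emeasure (completion (restrict_space M \<Omega>)) S"
    unfolding *(1) using * N by (intro emeasure_Un_null_set) auto
  also have "\<dots> = emeasure M S"
    using * S sub by (simp add: emeasure_restrict_space)
  also have "\<dots> = emeasure (completion M) A"
    unfolding *(1) using S N by (simp add: emeasure_Un_null_set)
  also have "\<dots> = emeasure (restrict_space (completion M) \<Omega>) A"
    using A sub(2) unfolding eq by (subst emeasure_restrict_space) (auto simp: sets_restrict_space_iff)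
  finally show "emeasure (completion (restrict_space M \<Omega>)) A
    = emeasure (restrict_space (completion M) \<Omega>) A" .
qed

section \<open>Lebesgue measure of the plane as a completed product\<close>

text \<open>Continuity only handles Borel sets. Lebesgue sets also require preimages of null sets to
  be null; the preimage of a null set under a projection is a strip over it, which has product
  measure zero.\<close>

lemma fst_lebesgue_measurable: "fst \<in> (lebesgue :: (real \<times> real) measure) \<rightarrow>\<^sub>M (lebesgue :: real measure)" (is "?m")
  and snd_lebesgue_measurable: "snd \<in> (lebesgue :: (real \<times> real) measure) \<rightarrow>\<^sub>M (lebesgue :: real measure)"
proof -
  have "fst \<in> (lebesgue :: (real \<times> real) measure) \<rightarrow>\<^sub>M lborel"
    by (rule measurable_completion) (simp add: borel_measurable_continuous_onI continuous_on_fst continuous_on_id)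
  moreover have "null_sets lborel \<subseteq> null_sets (distr (lebesgue :: (real \<times> real) measure) lborel fst)"
  proof
    fix A :: "real set" assume A: "A \<in> null_sets lborel"
    then have "A \<times> (UNIV :: real set) \<in> null_sets (lborel \<Otimes>\<^sub>M lborel)"
      by (intro lborel.times_in_null_sets1) auto
    then have "A \<times> (UNIV :: real set) \<in> null_sets lebesgue"
      by (simp add: lborel_prod null_sets_completionI)
    moreover have "fst -` A = A \<times> (UNIV :: real set)" by auto
    ultimately show "A \<in> null_sets (distr (lebesgue :: (real \<times> real) measure) lborel fst)"
      using A \<open>fst \<in> _ \<rightarrow>\<^sub>M lborel\<close> by (auto simp: null_sets_def emeasure_distr)
  qed
  ultimately show ?m by (rule completion.measurable_completion2)
  have "snd \<in> (lebesgue :: (real \<times> real) measure) \<rightarrow>\<^sub>M lborel"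
    by (rule measurable_completion) (simp add: borel_measurable_continuous_onI continuous_on_snd continuous_on_id)
  moreover have "null_sets lborel \<subseteq> null_sets (distr (lebesgue :: (real \<times> real) measure) lborel snd)"
  proof
    fix A :: "real set" assume A: "A \<in> null_sets lborel"
    then have "(UNIV :: real set) \<times> A \<in> null_sets (lborel \<Otimes>\<^sub>M lborel)"
      by (intro lborel.times_in_null_sets2) auto
    then have "(UNIV :: real set) \<times> A \<in> null_sets lebesgue"
      by (simp add: lborel_prod null_sets_completionI)
    moreover have "snd -` A = (UNIV :: real set) \<times> A" by auto
    ultimately show "A \<in> null_sets (distr (lebesgue :: (real \<times> real) measure) lborel snd)"
      using A \<open>snd \<in> _ \<rightarrow>\<^sub>M lborel\<close> by (auto simp: null_sets_def emeasure_distr)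
  qed
  ultimately show "snd \<in> (lebesgue :: (real \<times> real) measure) \<rightarrow>\<^sub>M (lebesgue :: real measure)"
    by (rule completion.measurable_completion2)
qed

lemma Times_lebesgue:
  assumes "S \<in> sets (lebesgue :: real measure)" "T \<in> sets (lebesgue :: real measure)"
  shows "S \<times> T \<in> sets lebesgue"
proof -
  have "S \<times> T = (fst -` S \<inter> space lebesgue) \<inter> (snd -` T \<inter> space lebesgue)" by auto
  also have "\<dots> \<in> sets lebesgue"
    using assms fst_lebesgue_measurable snd_lebesgue_measurable by (intro sets.Int measurable_sets)
  finally show ?thesis .
qed

text \<open>Each factor is a Borel set up to a null set, and the rectangle differs from the Borel
  rectangle only inside two null strips, so the product formula for Borel rectangles carries
  over.\<close>

lemma emeasure_lebesgue_Times:
  assumes S: "S \<in> sets (lebesgue :: real measure)" and T: "T \<in> sets (lebesgue :: real measure)"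
  shows "emeasure lebesgue (S \<times> T) = emeasure lebesgue S * emeasure lebesgue T"
proof -
  obtain S1 S2 S3 where s: "S = S1 \<union> S2" "S2 \<subseteq> S3" "S3 \<in> null_sets lborel" "S1 \<in> sets lborel"
    using sets_completionE[OF S] by metis
  obtain T1 T2 T3 where t: "T = T1 \<union> T2" "T2 \<subseteq> T3" "T3 \<in> null_sets lborel" "T1 \<in> sets lborel"
    using sets_completionE[OF T] by metis
  have n: "S2 \<in> null_sets lebesgue" "T2 \<in> null_sets lebesgue"
    using s t by (auto simp: null_sets_completion_iff2)
  let ?N = "S2 \<times> T \<union> S1 \<times> T2" and ?N' = "S3 \<times> UNIV \<union> UNIV \<times> T3"
  have "?N' \<in> null_sets (lborel \<Otimes>\<^sub>M lborel)"
    using s t by (intro null_sets.Un lborel.times_in_null_sets1 lborel.times_in_null_sets2) auto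
  then have N: "?N \<in> null_sets lebesgue"
    using s t unfolding null_sets_completion_iff2 lborel_prod by (intro bexI[of _ ?N']) auto
  have "emeasure lebesgue (S \<times> T) = emeasure lebesgue (S1 \<times> T1 \<union> ?N)"
    using s t by (intro arg_cong[of _ _ "emeasure _"]) auto
  also have "\<dots> = emeasure lebesgue (S1 \<times> T1)"
    using s t N Times_lebesgue by (intro emeasure_Un_null_set) auto
  also have "\<dots> = emeasure (lborel \<Otimes>\<^sub>M lborel) (S1 \<times> T1)"
    using pair_measureI[OF s(4) t(4)] unfolding lborel_prod by simp
  also have "\<dots> = emeasure lborel S1 * emeasure lborel T1"
    using s t by (intro lborel.emeasure_pair_measure_Times) auto
  also have "\<dots> = emeasure lebesgue S * emeasure lebesgue T"
    using s t n by (simp add: emeasure_Un_null_set)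
  finally show ?thesis .
qed

lemma measure_lebesgue_Times:
  assumes S: "S \<in> sets (lebesgue :: real measure)" and T: "T \<in> sets (lebesgue :: real measure)"
  shows "measure lebesgue (S \<times> T) = measure lebesgue S * measure lebesgue T"
  using emeasure_lebesgue_Times[OF assms] by (simp add: measure_def enn2real_mult)

abbreviation unit_interval_measure :: "real measure" where
  "unit_interval_measure \<equiv> lebesgue_on {0..1}"

abbreviation unit_square_measure :: "(real \<times> real) measure" where
  "unit_square_measure \<equiv> lebesgue_on ({0..1} \<times> {0..1})"

lemma square_lebesgue [simp, measurable]: "{0..1} \<times> {0..1} \<in> sets (lebesgue :: (real \<times> real) measure)"
  by (rule Times_lebesgue) auto

lemma finite_measure_unit_interval: "finite_measure unit_interval_measure"
  by (rule finite_measureI) (simp add: emeasure_restrict_space)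

lemma unit_square_id_measurable:
  "(\<lambda>z. z) \<in> unit_square_measure \<rightarrow>\<^sub>M unit_interval_measure \<Otimes>\<^sub>M unit_interval_measure"
proof -
  have "fst \<in> unit_square_measure \<rightarrow>\<^sub>M unit_interval_measure"
    by (intro measurable_restrict_space3 fst_lebesgue_measurable) auto
  moreover have "snd \<in> unit_square_measure \<rightarrow>\<^sub>M unit_interval_measure"
    by (intro measurable_restrict_space3 snd_lebesgue_measurable) auto
  ultimately show ?thesis by (subst measurable_pair_iff) (auto simp: comp_def)
qed

text \<open>The identity forgets the sets outside the product sigma-algebra. On rectangles both
  measures are products of lengths, which determines them; this lets invariance under a product map
  be read off on the completed square.\<close>

lemma unit_square_id_distr:
  "distr unit_square_measure (unit_interval_measure \<Otimes>\<^sub>M unit_interval_measure) (\<lambda>z. z)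
    = unit_interval_measure \<Otimes>\<^sub>M unit_interval_measure"
proof (rule pair_measure_eqI[symmetric])
  show "sigma_finite_measure unit_interval_measure" "sigma_finite_measure unit_interval_measure"
    using finite_measure_unit_interval by (simp_all add: finite_measure_def)
  fix A B assume AB: "A \<in> sets unit_interval_measure" "B \<in> sets unit_interval_measure"
  then have l: "A \<in> sets lebesgue" "B \<in> sets lebesgue" "A \<subseteq> {0..1}" "B \<subseteq> {0..1}"
    by (auto simp: sets_restrict_space_iff)
  have "emeasure (distr unit_square_measure (unit_interval_measure \<Otimes>\<^sub>M unit_interval_measure) (\<lambda>z. z)) (A \<times> B)
     = emeasure unit_square_measure (A \<times> B)"
    using AB l by (subst emeasure_distr[OF unit_square_id_measurable])
      (auto simp: space_restrict_space intro!: arg_cong[of _ _ "emeasure _"])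
  also have "\<dots> = emeasure lebesgue (A \<times> B)"
    using l by (intro emeasure_restrict_space) auto
  also have "\<dots> = emeasure unit_interval_measure A * emeasure unit_interval_measure B"
    using l by (simp add: emeasure_lebesgue_Times emeasure_restrict_space)
  finally show "emeasure unit_interval_measure A * emeasure unit_interval_measure B
    = emeasure (distr unit_square_measure (unit_interval_measure \<Otimes>\<^sub>M unit_interval_measure) (\<lambda>z. z)) (A \<times> B)"
    by simp
qed simp

text \<open>The Lebesgue sigma-algebra of the square is strictly larger than the product sigma-algebra,
  so invariance is first proved on Borel sets and then extended to the completion.\<close>

lemma mp_square:
  assumes "\<nu> \<in> mp_bijections"
  shows mp_square_measurable:
      "(\<lambda>(x, y). (\<nu> x, \<nu> y)) \<in> unit_square_measure \<rightarrow>\<^sub>M unit_square_measure" (is "?T \<in> _")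
    and mp_square_distr:
      "distr unit_square_measure unit_square_measure (\<lambda>(x, y). (\<nu> x, \<nu> y)) = unit_square_measure"
proof -
  let ?L = unit_square_measure and ?M = unit_interval_measure
  let ?Q = "{0..1} \<times> {0..1} :: (real \<times> real) set"
  let ?P = "?M \<Otimes>\<^sub>M ?M" and ?R = "restrict_space (lborel :: (real \<times> real) measure) ?Q"
  interpret M: finite_measure ?M by (rule finite_measure_unit_interval)
  have \<nu>: "\<nu> \<in> ?M \<rightarrow>\<^sub>M ?M" "distr ?M ?M \<nu> = ?M" using assms by (auto simp: mp_bijections_def)
  have TP: "?T \<in> ?P \<rightarrow>\<^sub>M ?P" using \<nu> by measurable
  have dP: "distr ?P ?P ?T = ?P"
    using pair_measure_distr[OF \<nu>(1) \<nu>(1)] \<nu>(2) M.sigma_finite_measure_axioms by simp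
  have TLP: "?T \<in> ?L \<rightarrow>\<^sub>M ?P"
    using measurable_compose[OF unit_square_id_measurable TP] by simp
  have dLP: "distr ?L ?P ?T = ?P"
    using distr_distr[OF TP unit_square_id_measurable] unit_square_id_distr dP by (simp add: comp_def)
  have Q: "?Q \<in> sets borel" "?Q \<inter> space lborel \<in> sets lborel" by (auto intro: borel_Times)
  have spM: "fst \<in> ?P \<rightarrow>\<^sub>M borel" "snd \<in> ?P \<rightarrow>\<^sub>M borel"
  proof -
    have *: "(\<lambda>x. x) \<in> ?M \<rightarrow>\<^sub>M borel"
      by (rule measurable_restrict_space1) (auto intro: measurable_completion)
    show "fst \<in> ?P \<rightarrow>\<^sub>M borel" by (rule measurable_compose[OF measurable_fst *])
    show "snd \<in> ?P \<rightarrow>\<^sub>M borel" by (rule measurable_compose[OF measurable_snd *])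
  qed
  \<comment> \<open>Borel subsets of the square belong to the product sigma-algebra, so maps into
    the product can be regarded as maps into the Borel square \<open>?R\<close>.\<close>
  have PR: "(\<lambda>z. z) \<in> ?P \<rightarrow>\<^sub>M ?R"
  proof (rule measurable_restrict_space2)
    show "(\<lambda>z. z) \<in> ?P \<rightarrow>\<^sub>M lborel"
      using borel_measurable_Pair[OF spM] by simp
  qed (auto simp: space_pair_measure)
  have TLR: "?T \<in> ?L \<rightarrow>\<^sub>M ?R" using measurable_compose[OF TLP PR] by simp
  have dR: "distr ?L ?R ?T = ?R"
  proof (rule measure_eqI)
    fix A assume "A \<in> sets (distr ?L ?R ?T)"
    then have A: "A \<in> sets ?R" by simp
    then have A': "A \<in> sets borel" "A \<subseteq> ?Q" using Q by (auto simp: sets_restrict_space_iff)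
    have AP: "A \<in> sets ?P"
      using measurable_sets[OF PR A] A' by (simp add: space_pair_measure Int_absorb2)
    have "emeasure (distr ?L ?R ?T) A = emeasure (distr ?L ?P ?T) A"
      using A AP TLR TLP by (simp add: emeasure_distr)
    also have "\<dots> = emeasure ?L A"
      unfolding dLP using A' AP
      by (subst unit_square_id_distr[symmetric], subst emeasure_distr[OF unit_square_id_measurable])
        (auto simp: space_restrict_space Int_absorb2)
    also have "\<dots> = emeasure ?R A" using A' Q by (simp add: emeasure_restrict_space)
    finally show "emeasure (distr ?L ?R ?T) A = emeasure ?R A" .
  qed simp
  \<comment> \<open>A map that pushes \<open>?L\<close> forward to \<open>?R\<close> pulls null sets
    of \<open>?R\<close> back to null sets, hence stays measurable and measure preserving when its
    target is completed.\<close>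
  have c: "completion ?R = ?L" using Q by (intro completion_restrict_space) simp
  then interpret L: complete_measure ?L
    using completion.complete_measure_axioms[of ?R] by simp
  show "?T \<in> ?L \<rightarrow>\<^sub>M ?L"
    using L.measurable_completion2[OF TLR] dR c by simp
  show "distr ?L ?L ?T = ?L"
    using L.completion_distr_eq[OF TLR] dR c by simp
qed

subsection \<open>Partition densities and the cut distance\<close>

definition unit_kernel :: "(real \<Rightarrow> real \<Rightarrow> real) \<Rightarrow> bool" where
  "unit_kernel W \<longleftrightarrow>
     (\<lambda>(x, y). W x y) \<in> borel_measurable unit_square_measure \<and>
     (\<forall>x\<in>{0..1}. \<forall>y\<in>{0..1}. \<bar>W x y\<bar> \<le> 1)"

definition cut_integral :: "(real \<Rightarrow> real \<Rightarrow> real) \<Rightarrow> real set \<Rightarrow> real set \<Rightarrow> real" where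
  "cut_integral W S T = (LINT (x, y) : S \<times> T | lebesgue. W x y)"

definition partition_density :: "nat \<Rightarrow> (real \<Rightarrow> real \<Rightarrow> real) \<Rightarrow> (nat \<Rightarrow> real set) \<Rightarrow> real" where
  "partition_density q W S = (\<Sum>i=1..q-1. \<Sum>j=i+1..q.
     1 / (measure lebesgue (S i) * measure lebesgue (S j)) * cut_integral W (S i) (S j))"

lemma graphon_cut_density_eq:
  "graphon_cut_density q c W = (INF S\<in>unit_balanced_partitions q c. partition_density q W S)"
proof -
  have *: "(LINT (x, y) : A \<times> B | lebesgue. k * W x y) = k * cut_integral W A B" for k A B
  proof -
    have "(LINT (x, y) : A \<times> B | lebesgue. k * W x y)
        = (LINT z : A \<times> B | lebesgue. k * (case z of (x, y) \<Rightarrow> W x y))"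
      by (simp add: case_prod_unfold)
    then show ?thesis by (simp add: cut_integral_def)
  qed
  show ?thesis unfolding graphon_cut_density_def partition_density_def * ..
qed

lemma graphon_unit_kernel: "graphon W \<Longrightarrow> unit_kernel W"
  by (auto simp: graphon_def unit_kernel_def)

text \<open>Moves the integral to a finite measure space, where bounded measurable functions are
  integrable and values of \<open>W\<close> outside the unit square are invisible.\<close>

lemma cut_integral_eq:
  assumes "S \<in> unit_measurable_sets" "T \<in> unit_measurable_sets"
  shows "cut_integral W S T
    = (LINT z | unit_square_measure. indicator (S \<times> T) z * (case z of (x, y) \<Rightarrow> W x y))"
proof -
  have "S \<times> T \<subseteq> {0..1} \<times> {0..1}" using assms by (auto simp: unit_measurable_sets_def)
  then have *: "indicator ({0..1} \<times> {0..1}) z * (indicator (S \<times> T) z * r) = indicator (S \<times> T) z * r"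
    for z and r :: real by (auto simp: indicator_def)
  show ?thesis
    unfolding cut_integral_def set_lebesgue_integral_def
    by (subst integral_restrict_space) (simp, simp only: real_scaleR_def *)
qed

lemma measure_unit_square: "measure unit_square_measure ({0..1} \<times> {0..1}) = 1"
  by (simp add: measure_restrict_space measure_lebesgue_Times)

lemma finite_measure_unit_square: "finite_measure unit_square_measure"
proof (rule finite_measureI)
  have "emeasure lebesgue {0..1::real} = 1" by simp
  then show "emeasure unit_square_measure (space unit_square_measure) \<noteq> \<infinity>"
    by (simp add: emeasure_restrict_space emeasure_lebesgue_Times del: emeasure_completion)
qed

lemma unit_kernel_integrable:
  assumes "unit_kernel W" "S \<in> unit_measurable_sets" "T \<in> unit_measurable_sets"
  shows "integrable unit_square_measure (\<lambda>z. indicator (S \<times> T) z * (case z of (x, y) \<Rightarrow> W x y))"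
proof -
  interpret finite_measure unit_square_measure by (rule finite_measure_unit_square)
  have "S \<times> T \<in> sets unit_square_measure"
    using assms by (auto simp: unit_measurable_sets_def sets_restrict_space_iff Times_lebesgue)
  moreover have "(\<lambda>(x, y). W x y) \<in> borel_measurable unit_square_measure"
    using assms(1) by (simp add: unit_kernel_def)
  ultimately have m: "(\<lambda>z. indicator (S \<times> T) z * (case z of (x, y) \<Rightarrow> W x y)) \<in> borel_measurable unit_square_measure"
    by (intro borel_measurable_times borel_measurable_indicator)
  show ?thesis
    by (rule integrable_const_bound[where B = 1, OF _ m])
      (use assms in \<open>auto simp: unit_kernel_def indicator_def space_restrict_space intro!: AE_I2\<close>)
qed

lemma cut_integral_diff:
  assumes "unit_kernel U" "unit_kernel W" "S \<in> unit_measurable_sets" "T \<in> unit_measurable_sets"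
  shows "cut_integral (\<lambda>x y. U x y - W x y) S T = cut_integral U S T - cut_integral W S T"
  unfolding cut_integral_eq[OF assms(3,4)]
    Bochner_Integration.integral_diff[OF unit_kernel_integrable[OF assms(1,3,4)]
      unit_kernel_integrable[OF assms(2,3,4)], symmetric]
  by (simp add: case_prod_unfold right_diff_distrib)

lemma abs_cut_integral_le:
  assumes "S \<in> unit_measurable_sets" "T \<in> unit_measurable_sets"
    and "\<And>x y. x \<in> {0..1} \<Longrightarrow> y \<in> {0..1} \<Longrightarrow> \<bar>W x y\<bar> \<le> B"
  shows "\<bar>cut_integral W S T\<bar> \<le> B"
proof -
  interpret finite_measure unit_square_measure by (rule finite_measure_unit_square)
  have B: "0 \<le> B" using assms(3)[of 0 0] by auto
  have "\<bar>cut_integral W S T\<bar> \<le> (LINT z | unit_square_measure. norm (indicator (S \<times> T) z * (case z of (x, y) \<Rightarrow> W x y)))"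
    unfolding cut_integral_eq[OF assms(1,2)] real_norm_def[symmetric] by (rule integral_norm_bound)
  also have "\<dots> \<le> (LINT z | unit_square_measure. B)"
    using assms(3) B by (intro integral_mono') (auto simp: indicator_def space_restrict_space)
  also have "\<dots> = B" using measure_unit_square by (simp add: space_restrict_space)
  finally show ?thesis .
qed

lemma abs_cut_integral_le_cut_norm:
  assumes "unit_kernel U" "unit_kernel W" "S \<in> unit_measurable_sets" "T \<in> unit_measurable_sets"
  shows "\<bar>cut_integral (\<lambda>x y. U x y - W x y) S T\<bar> \<le> cut_norm (\<lambda>x y. U x y - W x y)"
proof -
  \<comment> \<open>A supremum of reals bounds its members only if the family is bounded; a
    difference of two kernels has absolute value at most 2.\<close>
  have "bdd_above ((\<lambda>(S, T). \<bar>cut_integral (\<lambda>x y. U x y - W x y) S T\<bar>) ` (unit_measurable_sets \<times> unit_measurable_sets))"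
  proof (rule bdd_aboveI2[where M = 2])
    fix p assume "p \<in> unit_measurable_sets \<times> unit_measurable_sets"
    moreover have "\<bar>U x y - W x y\<bar> \<le> 2" if "x \<in> {0..1}" "y \<in> {0..1}" for x y
      using assms(1,2) that unfolding unit_kernel_def by (smt (verit))
    ultimately show "(case p of (S, T) \<Rightarrow> \<bar>cut_integral (\<lambda>x y. U x y - W x y) S T\<bar>) \<le> 2"
      using abs_cut_integral_le by auto
  qed
  then show ?thesis
    unfolding cut_norm_def using assms(3,4)
    by (intro cSUP_upper2[where x = "(S, T)"]) (auto simp: cut_integral_def)
qed

section \<open>Transport along measure preserving bijections\<close>

lemma unit_kernel_transport:
  assumes \<nu>: "\<nu> \<in> mp_bijections" and W: "unit_kernel W"
  shows "unit_kernel (\<lambda>x y. W (\<nu> x) (\<nu> y))"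
proof -
  have "\<nu> x \<in> {0..1}" if "x \<in> {0..1}" for x
    using \<nu> that by (auto simp: mp_bijections_def bij_betw_def)
  moreover have "(\<lambda>z. case (case z of (x, y) \<Rightarrow> (\<nu> x, \<nu> y)) of (x, y) \<Rightarrow> W x y) \<in> borel_measurable unit_square_measure"
    using W by (intro measurable_compose[OF mp_square_measurable[OF \<nu>], of "\<lambda>(x, y). W x y"]) (simp add: unit_kernel_def)
  ultimately show ?thesis using W by (simp add: unit_kernel_def case_prod_unfold)
qed

lemma mp_vimage:
  assumes \<nu>: "\<nu> \<in> mp_bijections" and S: "S \<in> unit_measurable_sets"
  shows mp_vimage_measurable: "\<nu> -` S \<inter> {0..1} \<in> unit_measurable_sets"
    and mp_vimage_measure: "measure lebesgue (\<nu> -` S \<inter> {0..1}) = measure lebesgue S"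
proof -
  have m: "\<nu> \<in> unit_interval_measure \<rightarrow>\<^sub>M unit_interval_measure"
    and d: "distr unit_interval_measure unit_interval_measure \<nu> = unit_interval_measure"
    using \<nu> by (auto simp: mp_bijections_def)
  have S': "S \<in> sets unit_interval_measure" "S \<in> sets lebesgue" "S \<subseteq> {0..1}"
    using S by (auto simp: unit_measurable_sets_def sets_restrict_space_iff)
  show "\<nu> -` S \<inter> {0..1} \<in> unit_measurable_sets"
    using measurable_sets[OF m S'(1)]
    by (auto simp: unit_measurable_sets_def sets_restrict_space_iff space_restrict_space)
  have "measure lebesgue (\<nu> -` S \<inter> {0..1}) = measure (distr unit_interval_measure unit_interval_measure \<nu>) S"
    using m S' by (simp add: measure_distr measure_restrict_space space_restrict_space)
  also have "\<dots> = measure lebesgue S"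
    unfolding d using S' by (simp add: measure_restrict_space)
  finally show "measure lebesgue (\<nu> -` S \<inter> {0..1}) = measure lebesgue S" .
qed

lemma cut_integral_transport:
  assumes \<nu>: "\<nu> \<in> mp_bijections" and W: "unit_kernel W"
    and S: "S \<in> unit_measurable_sets" and T: "T \<in> unit_measurable_sets"
  shows "cut_integral (\<lambda>x y. W (\<nu> x) (\<nu> y)) (\<nu> -` S \<inter> {0..1}) (\<nu> -` T \<inter> {0..1}) = cut_integral W S T"
proof -
  let ?f = "\<lambda>z. indicator (S \<times> T) z * (case z of (x, y) \<Rightarrow> W x y)"
  let ?T = "\<lambda>(x, y). (\<nu> x, \<nu> y)"
  have "cut_integral W S T = (LINT z | distr unit_square_measure unit_square_measure ?T. ?f z)"
    unfolding mp_square_distr[OF \<nu>] using S T by (rule cut_integral_eq)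
  also have "\<dots> = (LINT z | unit_square_measure. ?f (?T z))"
    using unit_kernel_integrable[OF W S T] mp_square_measurable[OF \<nu>] by (intro integral_distr) auto
  also have "\<dots> = cut_integral (\<lambda>x y. W (\<nu> x) (\<nu> y)) (\<nu> -` S \<inter> {0..1}) (\<nu> -` T \<inter> {0..1})"
    unfolding cut_integral_eq[OF mp_vimage_measurable[OF \<nu> S] mp_vimage_measurable[OF \<nu> T]]
    by (intro Bochner_Integration.integral_cong) (auto simp: indicator_def space_restrict_space)
  finally show ?thesis ..
qed

lemma unit_balanced_partition_measurable:
  "S \<in> unit_balanced_partitions q c \<Longrightarrow> i \<in> {1..q} \<Longrightarrow> S i \<in> unit_measurable_sets"
  unfolding unit_balanced_partitions_def unit_measurable_sets_def by blast

lemma partition_density_transport: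
  assumes \<nu>: "\<nu> \<in> mp_bijections" and W: "unit_kernel W" and S: "\<And>i. i \<in> {1..q} \<Longrightarrow> S i \<in> unit_measurable_sets"
  shows "partition_density q (\<lambda>x y. W (\<nu> x) (\<nu> y)) (\<lambda>i. \<nu> -` S i \<inter> {0..1}) = partition_density q W S"
  unfolding partition_density_def
  by (intro sum.cong refl arg_cong2[of _ _ _ _ "(*)"])
    (use mp_vimage_measure[OF \<nu>] cut_integral_transport[OF \<nu> W] S in simp_all)

lemma unit_balanced_partitions_vimage:
  assumes \<nu>: "\<nu> \<in> mp_bijections" and S: "S \<in> unit_balanced_partitions q c"
  shows "(\<lambda>i. \<nu> -` S i \<inter> {0..1}) \<in> unit_balanced_partitions q c"
proof -
  have S': "disjoint_family_on S {1..q}" "(\<Union>i\<in>{1..q}. S i) = {0..1}"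
     "(\<Sum>i=1..q. measure lebesgue (S i)) = 1" "\<forall>i\<in>{1..q}. measure lebesgue (S i) \<ge> c"
    using S by (auto simp: unit_balanced_partitions_def)
  have "\<nu> x \<in> {0..1}" if "x \<in> {0..1}" for x
    using \<nu> that by (auto simp: mp_bijections_def bij_betw_def)
  then have "(\<Union>i\<in>{1..q}. \<nu> -` S i \<inter> {0..1}) = {0..1}"
    unfolding S'(2)[symmetric] by fastforce
  moreover have "disjoint_family_on (\<lambda>i. \<nu> -` S i \<inter> {0..1}) {1..q}"
    using S'(1) unfolding disjoint_family_on_def by blast
  ultimately show ?thesis
    using S' mp_vimage_measure[OF \<nu> unit_balanced_partition_measurable[OF S]]
      mp_vimage_measurable[OF \<nu> unit_balanced_partition_measurable[OF S]]
    by (simp add: unit_balanced_partitions_def unit_measurable_sets_def)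
qed

text \<open>Preimages carry partitions only from the side of \<open>W\<close> to the side of
  \<open>U\<close>; the opposite inequality between the infima needs images. An image under
  \<open>\<nu>\<close> is a preimage under its inverse, so measurability of the inverse enters
  here.\<close>

lemma unit_balanced_partitions_image:
  assumes \<nu>: "\<nu> \<in> mp_bijections" and S: "S \<in> unit_balanced_partitions q c"
  obtains S' where "S' \<in> unit_balanced_partitions q c" "\<And>i. i \<in> {1..q} \<Longrightarrow> \<nu> -` S' i \<inter> {0..1} = S i"
proof -
  have b: "bij_betw \<nu> {0..1} {0..1}" and m: "inv_into {0..1} \<nu> \<in> unit_interval_measure \<rightarrow>\<^sub>M unit_interval_measure"
    using \<nu> by (auto simp: mp_bijections_def)
  have sub: "S i \<subseteq> {0..1}" if "i \<in> {1..q}" for i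
    using unit_balanced_partition_measurable[OF S that] by (simp add: unit_measurable_sets_def)
  have pre: "\<nu> -` (\<nu> ` S i) \<inter> {0..1} = S i" if "i \<in> {1..q}" for i
    using inj_on_image_mem_iff[OF bij_betw_imp_inj_on[OF b] _ sub[OF that]] sub[OF that] by blast
  have meas: "\<nu> ` S i \<in> unit_measurable_sets" if i: "i \<in> {1..q}" for i
  proof -
    have "\<nu> ` S i = inv_into {0..1} \<nu> -` S i \<inter> {0..1}"
    proof (intro set_eqI iffI)
      fix y assume "y \<in> \<nu> ` S i"
      then obtain x where x: "x \<in> S i" "y = \<nu> x" by blast
      then have "x \<in> {0..1}" using sub[OF i] by blast
      then show "y \<in> inv_into {0..1} \<nu> -` S i \<inter> {0..1}"
        using x b by (auto simp: bij_betw_def inv_into_f_f)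
    next
      fix y assume y: "y \<in> inv_into {0..1} \<nu> -` S i \<inter> {0..1}"
      then have "\<nu> (inv_into {0..1} \<nu> y) = y"
        using b by (auto simp: bij_betw_def intro!: f_inv_into_f)
      then show "y \<in> \<nu> ` S i" using y by (metis IntD1 imageI vimageD)
    qed
    then show ?thesis
      using unit_balanced_partition_measurable[OF S i] measurable_sets[OF m, of "S i"]
      by (auto simp: unit_measurable_sets_def sets_restrict_space_iff space_restrict_space)
  qed
  have measure: "measure lebesgue (\<nu> ` S i) = measure lebesgue (S i)" if "i \<in> {1..q}" for i
    using mp_vimage_measure[OF \<nu> meas[OF that]] pre[OF that] by simp
  have S': "disjoint_family_on S {1..q}" "(\<Union>i\<in>{1..q}. S i) = {0..1}"
     "(\<Sum>i=1..q. measure lebesgue (S i)) = 1" "\<forall>i\<in>{1..q}. measure lebesgue (S i) \<ge> c"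
    using S by (auto simp: unit_balanced_partitions_def)
  have "(\<Union>i\<in>{1..q}. \<nu> ` S i) = {0..1}"
    using S'(2) b by (metis bij_betw_imp_surj_on image_UN)
  moreover have "disjoint_family_on (\<lambda>i. \<nu> ` S i) {1..q}"
    unfolding disjoint_family_on_def
  proof (intro ballI impI)
    fix i j assume ij: "i \<in> {1..q}" "j \<in> {1..q}" "i \<noteq> j"
    have "\<nu> ` S i \<inter> \<nu> ` S j = \<nu> ` (S i \<inter> S j)"
      using b sub ij by (intro inj_on_image_Int[symmetric, of _ "{0..1}"]) (auto simp: bij_betw_def)
    then show "\<nu> ` S i \<inter> \<nu> ` S j = {}"
      using S'(1) ij by (simp add: disjoint_family_on_def)
  qed
  ultimately have "(\<lambda>i. \<nu> ` S i) \<in> unit_balanced_partitions q c"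
    using S' meas measure by (simp add: unit_balanced_partitions_def unit_measurable_sets_def)
  then show thesis using pre that by blast
qed

section \<open>Continuity of partition densities in the cut distance\<close>

text \<open>Balance keeps every denominator above \<open>c\<^sup>2\<close>, so each of at most q
  squared terms moves by at most the cut norm divided by \<open>c\<^sup>2\<close>. The bound does
  not depend on the partition.\<close>

lemma partition_density_cut_norm:
  assumes U: "unit_kernel U" and W: "unit_kernel W" and S: "S \<in> unit_balanced_partitions q c" and c: "0 < c"
  shows "\<bar>partition_density q U S - partition_density q W S\<bar> \<le> (real q / c)\<^sup>2 * cut_norm (\<lambda>x y. U x y - W x y)"
proof -
  let ?N = "cut_norm (\<lambda>x y. U x y - W x y)"
  have N: "\<bar>cut_integral (\<lambda>x y. U x y - W x y) A B\<bar> \<le> ?N" if "A \<in> unit_measurable_sets" "B \<in> unit_measurable_sets" for A B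
    using abs_cut_integral_le_cut_norm[OF U W that] .
  have N0: "0 \<le> ?N" using N[of "{}" "{}"] by (simp add: unit_measurable_sets_def)
  let ?m = "\<lambda>i. measure lebesgue (S i)"
  have bound: "\<bar>1 / (?m i * ?m j) * cut_integral U (S i) (S j) - 1 / (?m i * ?m j) * cut_integral W (S i) (S j)\<bar> \<le> ?N / c\<^sup>2"
    if ij: "i \<in> {1..q}" "j \<in> {1..q}" for i j
  proof -
    note m = unit_balanced_partition_measurable[OF S ij(1)] unit_balanced_partition_measurable[OF S ij(2)]
    have "c \<le> ?m i" "c \<le> ?m j" using S ij by (auto simp: unit_balanced_partitions_def)
    then have cc: "c\<^sup>2 \<le> ?m i * ?m j" using c by (simp add: power2_eq_square mult_mono)
    have "1 / (?m i * ?m j) * cut_integral U (S i) (S j) - 1 / (?m i * ?m j) * cut_integral W (S i) (S j)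
      = cut_integral (\<lambda>x y. U x y - W x y) (S i) (S j) / (?m i * ?m j)"
      unfolding cut_integral_diff[OF U W m] by (simp add: diff_divide_distrib)
    moreover have "\<bar>cut_integral (\<lambda>x y. U x y - W x y) (S i) (S j) / (?m i * ?m j)\<bar> \<le> ?N / c\<^sup>2"
      using cc c N[OF m] N0 by (simp add: abs_divide) (intro frac_le, auto)
    ultimately show ?thesis by simp
  qed
  have "\<bar>partition_density q U S - partition_density q W S\<bar> \<le> (\<Sum>i=1..q-1. \<Sum>j=i+1..q. ?N / c\<^sup>2)"
    unfolding partition_density_def sum_subtractf[symmetric]
    by (intro order.trans[OF sum_abs] sum_mono order.trans[OF sum_abs] bound) auto
  also have "\<dots> \<le> (\<Sum>i=1..q. \<Sum>j=1..q. ?N / c\<^sup>2)"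
    using N0 by (intro order.trans[OF sum_mono sum_mono2] sum_mono2 sum_nonneg) auto
  also have "\<dots> = (real q / c)\<^sup>2 * ?N" by (simp add: power2_eq_square)
  finally show ?thesis .
qed

lemma cut_dist_less:
  assumes "cut_dist U W < \<epsilon>"
  obtains \<nu> where "\<nu> \<in> mp_bijections" "cut_norm (\<lambda>x y. U x y - W (\<nu> x) (\<nu> y)) < \<epsilon>"
proof -
  \<comment> \<open>The identity makes the index set of the infimum nonempty; otherwise a small
    infimum would yield no bijection.\<close>
  have "id \<in> mp_bijections"
  proof -
    have "inv_into {0..1} id x = x" if "x \<in> {0..1::real}" for x
      using that by (metis id_apply inj_on_id inv_into_f_f)
    then have "inv_into {0..1} id \<in> unit_interval_measure \<rightarrow>\<^sub>M unit_interval_measure"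
      using measurable_cong[of unit_interval_measure "inv_into {0..1} id" id unit_interval_measure]
      by (simp add: space_restrict_space)
    then show ?thesis by (simp add: mp_bijections_def id_def distr_id bij_betw_def)
  qed
  then have "(\<lambda>\<nu>. cut_norm (\<lambda>x y. U x y - W (\<nu> x) (\<nu> y))) ` mp_bijections \<noteq> {}" by blast
  from cInf_lessD[OF this, of \<epsilon>] assms that show thesis
    unfolding cut_dist_def by blast
qed

text \<open>The partitions are matched in both directions, by preimage and by image under one
  near-optimal bijection, because each direction compares the two infima only one way.\<close>

lemma partition_density_cut_dist:
  assumes U: "unit_kernel U" and W: "unit_kernel W" and c: "0 < c" and less: "cut_dist U W < \<epsilon>"
    and S: "S \<in> unit_balanced_partitions q c"
  shows "\<exists>S'\<in>unit_balanced_partitions q c. \<bar>partition_density q U S' - partition_density q W S\<bar> \<le> (real q / c)\<^sup>2 * \<epsilon>"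
    and "\<exists>S'\<in>unit_balanced_partitions q c. \<bar>partition_density q U S - partition_density q W S'\<bar> \<le> (real q / c)\<^sup>2 * \<epsilon>"
proof -
  obtain \<nu> where \<nu>: "\<nu> \<in> mp_bijections" and N: "cut_norm (\<lambda>x y. U x y - W (\<nu> x) (\<nu> y)) < \<epsilon>"
    using cut_dist_less[OF less] .
  have close: "\<bar>partition_density q U S - partition_density q (\<lambda>x y. W (\<nu> x) (\<nu> y)) S\<bar> \<le> (real q / c)\<^sup>2 * \<epsilon>"
    if "S \<in> unit_balanced_partitions q c" for S
    by (rule order.trans[OF partition_density_cut_norm[OF U unit_kernel_transport[OF \<nu> W] that c]])
      (use N in \<open>simp add: mult_left_mono\<close>)
  show "\<exists>S'\<in>unit_balanced_partitions q c. \<bar>partition_density q U S' - partition_density q W S\<bar> \<le> (real q / c)\<^sup>2 * \<epsilon>"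
    using close[OF unit_balanced_partitions_vimage[OF \<nu> S]]
      partition_density_transport[OF \<nu> W unit_balanced_partition_measurable[OF S]]
      unit_balanced_partitions_vimage[OF \<nu> S] by auto
  obtain S' where S': "S' \<in> unit_balanced_partitions q c" "\<And>i. i \<in> {1..q} \<Longrightarrow> \<nu> -` S' i \<inter> {0..1} = S i"
    by (rule unit_balanced_partitions_image[OF \<nu> S]) blast
  have "partition_density q W S' = partition_density q (\<lambda>x y. W (\<nu> x) (\<nu> y)) (\<lambda>i. \<nu> -` S' i \<inter> {0..1})"
    using partition_density_transport[OF \<nu> W unit_balanced_partition_measurable[OF S'(1)]] by simp
  also have "\<dots> = partition_density q (\<lambda>x y. W (\<nu> x) (\<nu> y)) S"
    unfolding partition_density_def by (intro sum.cong refl) (use S'(2) in auto)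
  finally have "\<bar>partition_density q U S - partition_density q W S'\<bar> \<le> (real q / c)\<^sup>2 * \<epsilon>"
    using close[OF S] by simp
  then show "\<exists>S'\<in>unit_balanced_partitions q c. \<bar>partition_density q U S - partition_density q W S'\<bar> \<le> (real q / c)\<^sup>2 * \<epsilon>"
    using S'(1) by blast
qed

subsection \<open>Rounding fractional partitions\<close>

definition unit_row :: "nat \<Rightarrow> nat \<Rightarrow> real" where
  "unit_row i = (\<lambda>j. if j = i then 1 else 0)"

text \<open>Affinity in a row is expressed on the hyperplane of rows with sum 1, as a combination of
  the values at the vertices of the simplex. Restricting to this hyperplane makes constants qualify,
  and the identity is literally the average needed for rounding.\<close>

definition multiaffine :: "nat set \<Rightarrow> nat set \<Rightarrow> ((nat \<Rightarrow> nat \<Rightarrow> real) \<Rightarrow> real) \<Rightarrow> bool" where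
  "multiaffine I N F \<longleftrightarrow>
     (\<forall>u\<in>N. \<forall>x. (\<Sum>i\<in>I. x u i) = 1 \<longrightarrow> F x = (\<Sum>i\<in>I. x u i * F (x(u := unit_row i))))"

lemma multiaffine_const: "multiaffine I N (\<lambda>x. k)"
  by (simp add: multiaffine_def flip: sum_distrib_right)

lemma multiaffine_add:
  "multiaffine I N F \<Longrightarrow> multiaffine I N H \<Longrightarrow> multiaffine I N (\<lambda>x. F x + H x)"
  by (simp add: multiaffine_def distrib_left sum.distrib)

lemma multiaffine_cmult: "multiaffine I N F \<Longrightarrow> multiaffine I N (\<lambda>x. k * F x)"
  by (simp add: multiaffine_def sum_distrib_left mult.left_commute)

lemma multiaffine_sum:
  "(\<And>a. a \<in> A \<Longrightarrow> multiaffine I N (F a)) \<Longrightarrow> multiaffine I N (\<lambda>x. \<Sum>a\<in>A. F a x)"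
  by (induction A rule: infinite_finite_induct) (simp_all add: multiaffine_const multiaffine_add)

lemma sum_unit_row: "finite I \<Longrightarrow> j \<in> I \<Longrightarrow> (\<Sum>i\<in>I. a i * unit_row i j) = a j"
  by (simp add: unit_row_def if_distrib sum.delta cong: if_cong)

lemma multiaffine_coord: "finite I \<Longrightarrow> j \<in> I \<Longrightarrow> multiaffine I N (\<lambda>x. x w j)"
  unfolding multiaffine_def
proof (intro ballI allI impI)
  fix u and x :: "nat \<Rightarrow> nat \<Rightarrow> real" assume "finite I" "j \<in> I" "(\<Sum>i\<in>I. x u i) = 1"
  then show "x w j = (\<Sum>i\<in>I. x u i * (x(u := unit_row i)) w j)"
    by (cases "u = w") (simp_all add: sum_unit_row flip: sum_distrib_right)
qed

text \<open>The two factors sit in different rows, so replacing one row changes at most one of them.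
  A product of two entries of the same row would be quadratic, which is why diagonal terms must be
  removed from the functional.\<close>

lemma multiaffine_coord_mult:
  assumes "finite I" "j \<in> I" "k \<in> I" "v \<noteq> w"
  shows "multiaffine I N (\<lambda>x. x v j * x w k)"
  unfolding multiaffine_def
proof (intro ballI allI impI)
  fix u and x :: "nat \<Rightarrow> nat \<Rightarrow> real" assume 1: "(\<Sum>i\<in>I. x u i) = 1"
  consider "u = v" | "u = w" | "u \<noteq> v" "u \<noteq> w" by blast
  then show "x v j * x w k = (\<Sum>i\<in>I. x u i * ((x(u := unit_row i)) v j * (x(u := unit_row i)) w k))"
  proof cases
    case 1
    then show ?thesis using assms by (simp add: sum_unit_row flip: sum_distrib_right mult.assoc)
  next
    case 2
    then show ?thesis using assms sum_unit_row[of I k "\<lambda>i. x w i * x v j"] by (simp add: ac_simps)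
  next
    case 3
    then show ?thesis using 1 by (simp flip: sum_distrib_right)
  qed
qed

text \<open>A weighted average is at least one of the values averaged, so some unit vector can
  replace the row without increasing \<open>F\<close>. Rows already rounded stay fixed while the
  next one is treated.\<close>

lemma multiaffine_rounding:
  assumes "finite M" "M \<subseteq> N" "finite I" and F: "multiaffine I N F"
    and x: "\<And>u i. u \<in> M \<Longrightarrow> i \<in> I \<Longrightarrow> 0 \<le> x u i" "\<And>u. u \<in> M \<Longrightarrow> (\<Sum>i\<in>I. x u i) = 1"
  shows "\<exists>f. f ` M \<subseteq> I \<and> F (\<lambda>u. if u \<in> M then unit_row (f u) else x u) \<le> F x"
  using assms(1,2) x
proof (induction M rule: finite_induct)
  case (insert u M)
  then obtain f where f: "f ` M \<subseteq> I" "F (\<lambda>u. if u \<in> M then unit_row (f u) else x u) \<le> F x"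
    by auto
  define z where "z = (\<lambda>u. if u \<in> M then unit_row (f u) else x u)"
  have zu: "z u = x u" using insert.hyps by (simp add: z_def)
  have "\<exists>i\<in>I. F (z(u := unit_row i)) \<le> F z"
  proof (rule ccontr)
    assume "\<not> (\<exists>i\<in>I. F (z(u := unit_row i)) \<le> F z)"
    then have less: "F z < F (z(u := unit_row i))" if "i \<in> I" for i using that by force
    have "F z = (\<Sum>i\<in>I. x u i * F z)"
      using insert.prems(3)[of u] by (simp flip: sum_distrib_right)
    also have "\<dots> < (\<Sum>i\<in>I. x u i * F (z(u := unit_row i)))"
    proof (rule sum_strict_mono_ex1[OF \<open>finite I\<close>])
      show "\<forall>i\<in>I. x u i * F z \<le> x u i * F (z(u := unit_row i))"
        using less insert.prems(2) by (intro ballI mult_left_mono) (auto intro: less_imp_le)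
      \<comment> \<open>Vanishing weights contribute no strict inequality; since the weights sum to
        1, at least one of them does.\<close>
      have "\<exists>i\<in>I. x u i \<noteq> 0" using insert.prems(3)[of u] by (metis insertI1 sum.neutral zero_neq_one)
      then obtain i where "i \<in> I" "x u i \<noteq> 0" by blast
      then show "\<exists>i\<in>I. x u i * F z < x u i * F (z(u := unit_row i))"
        using less insert.prems(2)[of u i] by (intro bexI[of _ i] mult_strict_left_mono) auto
    qed
    also have "\<dots> = F z"
    proof -
      have "u \<in> N" "(\<Sum>i\<in>I. z u i) = 1" using insert.prems(1,3) zu by auto
      then show ?thesis using F unfolding multiaffine_def by (metis (no_types, lifting) sum.cong zu)
    qed
    finally show False by simp
  qed
  then obtain i where i: "i \<in> I" "F (z(u := unit_row i)) \<le> F z" by blast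
  have "(\<lambda>w. if w \<in> insert u M then unit_row ((f(u := i)) w) else x w) = z(u := unit_row i)"
    using insert.hyps by (auto simp: z_def fun_eq_iff)
  then show ?case
    using f i insert.hyps by (intro exI[of _ "f(u := i)"]) (auto simp: z_def)
qed auto

section \<open>Densities of fractional partitions\<close>

text \<open>Row \<open>x u\<close> tells how vertex \<open>u\<close> is divided among the classes,
  and \<open>p\<close> holds relative weights. Genuine vertex partitions are the 0-1
  matrices.\<close>

definition frac_mass :: "nat set \<Rightarrow> (nat \<Rightarrow> real) \<Rightarrow> (nat \<Rightarrow> nat \<Rightarrow> real) \<Rightarrow> nat \<Rightarrow> real" where
  "frac_mass N p x i = (\<Sum>u\<in>N. p u * x u i)"

definition frac_edges :: "nat set \<Rightarrow> (nat \<Rightarrow> real) \<Rightarrow> (nat \<Rightarrow> nat \<Rightarrow> real) \<Rightarrow> (nat \<Rightarrow> nat \<Rightarrow> real) \<Rightarrow> nat \<Rightarrow> nat \<Rightarrow> real" where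
  "frac_edges N p \<beta> x i j = (\<Sum>u\<in>N. \<Sum>v\<in>N. p u * p v * \<beta> u v * (x u i * x v j))"

definition frac_density :: "nat set \<Rightarrow> (nat \<Rightarrow> real) \<Rightarrow> (nat \<Rightarrow> nat \<Rightarrow> real) \<Rightarrow> nat \<Rightarrow> (nat \<Rightarrow> nat \<Rightarrow> real) \<Rightarrow> real" where
  "frac_density N p \<beta> q x = (\<Sum>i=1..q-1. \<Sum>j=i+1..q.
     1 / (frac_mass N p x i * frac_mass N p x j) * frac_edges N p \<beta> x i j)"

lemma pair_sum_le:
  fixes f g :: "nat \<Rightarrow> nat \<Rightarrow> real"
  assumes "\<And>i j. i \<in> {1..q} \<Longrightarrow> j \<in> {1..q} \<Longrightarrow> i < j \<Longrightarrow> f i j \<le> g i j + k" and k: "0 \<le> k"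
  shows "(\<Sum>i=1..q-1. \<Sum>j=i+1..q. f i j) \<le> (\<Sum>i=1..q-1. \<Sum>j=i+1..q. g i j) + (real q)\<^sup>2 * k"
proof -
  have "(\<Sum>i=1..q-1. \<Sum>j=i+1..q. f i j) \<le> (\<Sum>i=1..q-1. \<Sum>j=i+1..q. g i j + k)"
    by (intro sum_mono assms(1)) auto
  also have "\<dots> = (\<Sum>i=1..q-1. \<Sum>j=i+1..q. g i j) + (\<Sum>i=1..q-1. \<Sum>j=i+1..q. k)"
    by (simp add: sum.distrib)
  also have "(\<Sum>i=1..q-1. \<Sum>j=i+1..q. k) \<le> (\<Sum>i=1..q-1. \<Sum>j=1..q. k)"
    using k by (intro sum_mono sum_mono2) auto
  also have "\<dots> \<le> (\<Sum>i=1..q. \<Sum>j=1..q. k)"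
    using k by (intro sum_mono2) auto
  also have "\<dots> = (real q)\<^sup>2 * k" by (simp add: power2_eq_square)
  finally show ?thesis by simp
qed

text \<open>Of the constant 3, one unit is the change of the numerator; the other two are the change
  of the product of denominators, whose factors \<open>b\<close> and \<open>a'\<close> are at most
  1. The disjunction serves two uses: under mixing, the edge mass \<open>e\<close> belongs to the
  old masses \<open>a\<close> and \<open>b\<close>; under rounding, it belongs to the new
  ones.\<close>

lemma ratio_perturb:
  fixes a b a' b' c e e' k :: real
  assumes "0 < c" "c \<le> a" "c \<le> b" "c \<le> a'" "c \<le> b'" "a' \<le> 1" "b \<le> 1" "0 \<le> e" "e \<le> a * b \<or> e \<le> a' * b'"
    and "\<bar>a' - a\<bar> \<le> k" "\<bar>b' - b\<bar> \<le> k" "e' \<le> e + k"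
  shows "1 / (a' * b') * e' \<le> 1 / (a * b) * e + 3 / c\<^sup>2 * k"
proof -
  have pos: "0 < a" "0 < b" "0 < a'" "0 < b'" using assms by auto
  have c2: "c\<^sup>2 \<le> a * b" "c\<^sup>2 \<le> a' * b'"
    unfolding power2_eq_square using assms(1-5) by (auto intro!: mult_mono)
  have k: "0 \<le> k" using assms(10) by auto
  have "\<bar>a * b - a' * b'\<bar> = \<bar>(a - a') * b + a' * (b - b')\<bar>" by (simp add: algebra_simps)
  also have "\<dots> \<le> \<bar>a' - a\<bar> * b + a' * \<bar>b' - b\<bar>"
    using pos by (intro order.trans[OF abs_triangle_ineq]) (simp add: abs_mult abs_minus_commute)
  also have "\<dots> \<le> k * 1 + 1 * k" using assms pos k by (intro add_mono mult_mono) auto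
  finally have ab: "\<bar>a * b - a' * b'\<bar> \<le> 2 * k" by simp
  have "1 / (a' * b') * e' \<le> 1 / (a' * b') * (e + k)"
    using assms pos by (intro mult_left_mono) auto
  also have "\<dots> = 1 / (a * b) * e + (k / (a' * b') + e / ((a * b) * (a' * b')) * (a * b - a' * b'))"
    using pos by (simp add: field_simps)
  also have "k / (a' * b') + e / ((a * b) * (a' * b')) * (a * b - a' * b') \<le> k / c\<^sup>2 + 1 / c\<^sup>2 * (2 * k)"
  proof (rule add_mono)
    show "k / (a' * b') \<le> k / c\<^sup>2" using k c2(2) assms(1) by (intro frac_le) auto
    have "e / ((a * b) * (a' * b')) \<le> 1 / c\<^sup>2"
      using assms(9)
    proof
      assume "e \<le> a * b"
      then have "e / (a * b) / (a' * b') \<le> 1 / c\<^sup>2"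
        using pos assms(1) c2(2) by (intro frac_le) (auto simp: divide_le_eq)
      then show ?thesis by simp
    next
      assume "e \<le> a' * b'"
      then have "e / (a' * b') / (a * b) \<le> 1 / c\<^sup>2"
        using pos assms(1) c2(1) by (intro frac_le) (auto simp: divide_le_eq)
      then show ?thesis by (simp add: mult.commute)
    qed
    moreover have "0 \<le> e / ((a * b) * (a' * b'))" using pos assms(8) by simp
    ultimately show "e / ((a * b) * (a' * b')) * (a * b - a' * b') \<le> 1 / c\<^sup>2 * (2 * k)"
      using ab by (intro order.trans[OF mult_left_mono[of _ "2 * k"] mult_right_mono]) auto
  qed
  finally show ?thesis by simp
qed

locale vertex_weights =
  fixes N :: "nat set" and p :: "nat \<Rightarrow> real" and \<beta> :: "nat \<Rightarrow> nat \<Rightarrow> real"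
  assumes fin: "finite N" and p_nonneg: "\<And>u. u \<in> N \<Longrightarrow> 0 \<le> p u" and p_sum: "(\<Sum>u\<in>N. p u) = 1"
    and \<beta>: "\<And>u v. u \<in> N \<Longrightarrow> v \<in> N \<Longrightarrow> 0 \<le> \<beta> u v \<and> \<beta> u v \<le> 1"
begin

definition stochastic :: "nat \<Rightarrow> (nat \<Rightarrow> nat \<Rightarrow> real) \<Rightarrow> bool" where
  "stochastic q x \<longleftrightarrow> (\<forall>u\<in>N. (\<forall>i\<in>{1..q}. 0 \<le> x u i) \<and> (\<Sum>i=1..q. x u i) = 1)"

lemma stochastic_bounds:
  assumes "stochastic q x" "u \<in> N" "i \<in> {1..q}"
  shows "0 \<le> x u i" "x u i \<le> 1"
proof -
  show "0 \<le> x u i" using assms by (auto simp: stochastic_def)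
  have "x u i \<le> (\<Sum>i=1..q. x u i)" using assms by (intro member_le_sum) (auto simp: stochastic_def)
  then show "x u i \<le> 1" using assms by (auto simp: stochastic_def)
qed

lemma frac_mass_le_1:
  assumes "stochastic q x" "i \<in> {1..q}" shows "frac_mass N p x i \<le> 1"
proof -
  have "frac_mass N p x i \<le> (\<Sum>u\<in>N. p u * 1)"
    unfolding frac_mass_def using assms p_nonneg stochastic_bounds by (intro sum_mono mult_left_mono) auto
  then show ?thesis using p_sum by simp
qed

lemma frac_edges_nonneg:
  assumes "stochastic q x" "i \<in> {1..q}" "j \<in> {1..q}" shows "0 \<le> frac_edges N p \<beta> x i j"
  unfolding frac_edges_def
  by (intro sum_nonneg mult_nonneg_nonneg)
    (use assms p_nonneg \<beta> stochastic_bounds in auto)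

lemma frac_edges_le:
  assumes "stochastic q x" "i \<in> {1..q}" "j \<in> {1..q}"
  shows "frac_edges N p \<beta> x i j \<le> frac_mass N p x i * frac_mass N p x j"
proof -
  have "frac_edges N p \<beta> x i j \<le> (\<Sum>u\<in>N. \<Sum>v\<in>N. p u * p v * 1 * (x u i * x v j))"
    unfolding frac_edges_def
    by (intro sum_mono mult_mono mult_nonneg_nonneg) (use assms p_nonneg \<beta> stochastic_bounds in auto)
  also have "\<dots> = frac_mass N p x i * frac_mass N p x j"
    by (simp add: frac_mass_def sum_product ac_simps)
  finally show ?thesis .
qed

text \<open>Mixing with the uniform assignment creates slack in the balance constraint; this is where
  \<open>c < 1 / q\<close> enters, and the slack absorbs the rounding error of the masses.\<close>

lemma frac_density_mix:
  assumes x: "stochastic q x" and \<eta>: "0 \<le> \<eta>" "\<eta> \<le> 1" and q: "1 \<le> q" and c: "0 < c" "c \<le> 1 / real q"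
    and mass: "\<And>i. i \<in> {1..q} \<Longrightarrow> c \<le> frac_mass N p x i"
  defines "y \<equiv> \<lambda>u i. (1 - \<eta>) * x u i + \<eta> / real q"
  shows "stochastic q y"
    and "\<And>i. i \<in> {1..q} \<Longrightarrow> c + \<eta> * (1 / real q - c) \<le> frac_mass N p y i"
    and "frac_density N p \<beta> q y \<le> frac_density N p \<beta> q x + (real q)\<^sup>2 * (3 / c\<^sup>2 * (2 * \<eta>))"
proof -
  show y: "stochastic q y"
    using x \<eta> q by (auto simp: stochastic_def y_def sum.distrib simp flip: sum_distrib_left)
  have my: "frac_mass N p y i = (1 - \<eta>) * frac_mass N p x i + \<eta> / real q" for i
  proof -
    have "frac_mass N p y i = (\<Sum>u\<in>N. (1 - \<eta>) * (p u * x u i) + p u * (\<eta> / real q))"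
      unfolding frac_mass_def y_def by (intro sum.cong) (auto simp: algebra_simps)
    also have "\<dots> = (1 - \<eta>) * frac_mass N p x i + (\<Sum>u\<in>N. p u) * (\<eta> / real q)"
      unfolding frac_mass_def sum.distrib sum_distrib_left sum_distrib_right ..
    finally show ?thesis using p_sum by simp
  qed
  have lower: "c + \<eta> * (1 / real q - c) \<le> frac_mass N p y i" if "i \<in> {1..q}" for i
  proof -
    have "(1 - \<eta>) * c \<le> (1 - \<eta>) * frac_mass N p x i" using mass[OF that] \<eta> by (intro mult_left_mono) auto
    then show ?thesis unfolding my by (simp add: algebra_simps)
  qed
  then show "\<And>i. i \<in> {1..q} \<Longrightarrow> c + \<eta> * (1 / real q - c) \<le> frac_mass N p y i" .
  have yx: "\<bar>y u i - x u i\<bar> \<le> \<eta>" if "u \<in> N" "i \<in> {1..q}" for u i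
  proof -
    have "y u i - x u i = \<eta> * (1 / real q - x u i)" by (simp add: y_def algebra_simps)
    moreover have "\<bar>1 / real q - x u i\<bar> \<le> 1"
    proof -
      have "0 \<le> 1 / real q" "1 / real q \<le> 1" using q by auto
      then show ?thesis using stochastic_bounds[OF x that] by linarith
    qed
    ultimately show ?thesis using \<eta> by (simp add: abs_mult mult_left_le)
  qed
  \<comment> \<open>The masses move by at most \<open>\<eta>\<close>; the weaker bound is recorded
    because \<open>ratio_perturb\<close> takes one common error for masses and edges.\<close>
  have mxy: "\<bar>frac_mass N p y i - frac_mass N p x i\<bar> \<le> 2 * \<eta>" if "i \<in> {1..q}" for i
  proof -
    have "\<bar>frac_mass N p y i - frac_mass N p x i\<bar> = \<bar>\<Sum>u\<in>N. p u * (y u i - x u i)\<bar>"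
      unfolding frac_mass_def by (simp add: sum_subtractf right_diff_distrib)
    also have "\<dots> \<le> (\<Sum>u\<in>N. p u * \<eta>)"
      using yx that p_nonneg by (intro order.trans[OF sum_abs] sum_mono) (auto simp: abs_mult intro!: mult_left_mono)
    also have "\<dots> \<le> 2 * \<eta>" using p_sum \<eta> by (simp flip: sum_distrib_right)
    finally show ?thesis .
  qed
  have exy: "frac_edges N p \<beta> y i j \<le> frac_edges N p \<beta> x i j + 2 * \<eta>" if ij: "i \<in> {1..q}" "j \<in> {1..q}" for i j
  proof -
    have "frac_edges N p \<beta> y i j - frac_edges N p \<beta> x i j
        = (\<Sum>u\<in>N. \<Sum>v\<in>N. p u * p v * \<beta> u v * (y u i * y v j - x u i * x v j))"
      unfolding frac_edges_def by (simp add: sum_subtractf right_diff_distrib)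
    also have "\<dots> \<le> (\<Sum>u\<in>N. \<Sum>v\<in>N. p u * p v * 1 * (2 * \<eta>))"
    proof (intro sum_mono)
      fix u v assume uv: "u \<in> N" "v \<in> N"
      have "y u i * y v j - x u i * x v j = (y u i - x u i) * y v j + x u i * (y v j - x v j)"
        by (simp add: algebra_simps)
      also have "\<dots> \<le> \<bar>y u i - x u i\<bar> * y v j + x u i * \<bar>y v j - x v j\<bar>"
        using stochastic_bounds(1)[OF x uv(1) ij(1)] stochastic_bounds(1)[OF y uv(2) ij(2)]
        by (intro add_mono mult_right_mono mult_left_mono abs_ge_self)
      also have "\<dots> \<le> \<eta> * 1 + 1 * \<eta>"
        using stochastic_bounds[OF x] stochastic_bounds[OF y] uv ij yx \<eta> by (intro add_mono mult_mono) auto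
      finally have d: "y u i * y v j - x u i * x v j \<le> 2 * \<eta>" by simp
      have b: "0 \<le> p u * p v * \<beta> u v" "p u * p v * \<beta> u v \<le> p u * p v * 1"
        using uv p_nonneg \<beta> by (auto intro!: mult_nonneg_nonneg mult_left_mono simp del: mult_1_right)
      have "p u * p v * \<beta> u v * (y u i * y v j - x u i * x v j) \<le> p u * p v * \<beta> u v * (2 * \<eta>)"
        using b d by (intro mult_left_mono)
      also have "\<dots> \<le> p u * p v * 1 * (2 * \<eta>)" using b \<eta> by (intro mult_right_mono) auto
      finally show "p u * p v * \<beta> u v * (y u i * y v j - x u i * x v j) \<le> p u * p v * 1 * (2 * \<eta>)" .
    qed
    also have "\<dots> = (\<Sum>u\<in>N. p u) * (\<Sum>v\<in>N. p v) * (2 * \<eta>)"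
      unfolding sum_product by (simp add: sum_distrib_right)
    finally show ?thesis using p_sum by simp
  qed
  show "frac_density N p \<beta> q y \<le> frac_density N p \<beta> q x + (real q)\<^sup>2 * (3 / c\<^sup>2 * (2 * \<eta>))"
    unfolding frac_density_def
  proof (rule pair_sum_le)
    fix i j assume ij: "i \<in> {1..q}" "j \<in> {1..q}"
    have "c \<le> frac_mass N p y k" if "k \<in> {1..q}" for k
      using lower[OF that] \<eta> c by (smt (verit) mult_nonneg_nonneg)
    then show "1 / (frac_mass N p y i * frac_mass N p y j) * frac_edges N p \<beta> y i j
      \<le> 1 / (frac_mass N p x i * frac_mass N p x j) * frac_edges N p \<beta> x i j + 3 / c\<^sup>2 * (2 * \<eta>)"
      using ij mass c mxy exy \<eta>(1) frac_mass_le_1[OF x] frac_mass_le_1[OF y] frac_edges_nonneg[OF x] frac_edges_le[OF x]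
      by (intro ratio_perturb) auto
  qed (use \<eta> c in auto)
qed

text \<open>The diagonal terms \<open>(p u * x u i)\<^sup>2\<close> of the squared masses are replaced by
  \<open>(p u)\<^sup>2 * x u i\<close>: both agree on 0-1 matrices, and the result is affine in every row.\<close>

definition penalized :: "nat \<Rightarrow> (nat \<Rightarrow> real) \<Rightarrow> real \<Rightarrow> (nat \<Rightarrow> nat \<Rightarrow> real) \<Rightarrow> real" where
  "penalized q b K x =
     (\<Sum>i=1..q-1. \<Sum>j=i+1..q. 1 / (b i * b j) *
        (\<Sum>u\<in>N. \<Sum>v\<in>N-{u}. p u * p v * \<beta> u v * (x u i * x v j))) +
     K * (\<Sum>i=1..q. (\<Sum>u\<in>N. \<Sum>v\<in>N-{u}. p u * p v * (x u i * x v i)) +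
        (\<Sum>u\<in>N. ((p u)\<^sup>2 - 2 * b i * p u) * x u i) + (b i)\<^sup>2)"

lemma multiaffine_penalized: "multiaffine {1..q} N (penalized q b K)"
  unfolding penalized_def[abs_def]
  by (intro multiaffine_add multiaffine_cmult multiaffine_sum multiaffine_coord_mult multiaffine_coord
      multiaffine_const) auto

text \<open>The additional sum is the variance of the mass of class \<open>i\<close> when vertices
  are assigned independently with the rows as distributions. It is the whole price of making the
  squared deviation affine in each row.\<close>

lemma penalty_eq:
  "(\<Sum>u\<in>N. \<Sum>v\<in>N-{u}. p u * p v * (x u i * x v i)) + (\<Sum>u\<in>N. ((p u)\<^sup>2 - 2 * b * p u) * x u i) + b\<^sup>2
    = (frac_mass N p x i - b)\<^sup>2 + (\<Sum>u\<in>N. (p u)\<^sup>2 * (x u i - (x u i)\<^sup>2))"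
proof -
  have 1: "(\<Sum>u\<in>N. \<Sum>v\<in>N-{u}. p u * p v * (x u i * x v i)) = (frac_mass N p x i)\<^sup>2 - (\<Sum>u\<in>N. (p u)\<^sup>2 * (x u i)\<^sup>2)"
  proof -
    have "(\<Sum>u\<in>N. \<Sum>v\<in>N-{u}. p u * p v * (x u i * x v i))
       = (\<Sum>u\<in>N. (\<Sum>v\<in>N. p u * p v * (x u i * x v i)) - (p u)\<^sup>2 * (x u i)\<^sup>2)"
      using fin by (intro sum.cong refl) (simp add: sum_diff1 power2_eq_square ac_simps)
    then show ?thesis
      by (simp add: sum_subtractf frac_mass_def power2_eq_square sum_product ac_simps)
  qed
  have 2: "(\<Sum>u\<in>N. ((p u)\<^sup>2 - 2 * b * p u) * x u i) = (\<Sum>u\<in>N. (p u)\<^sup>2 * x u i) - 2 * b * frac_mass N p x i"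
    by (simp add: frac_mass_def left_diff_distrib sum_subtractf sum_distrib_left mult.assoc)
  show ?thesis
    unfolding 1 2 by (simp add: right_diff_distrib sum_subtractf power2_diff)
qed

lemma frac_edges_offdiag:
  "frac_edges N p \<beta> x i j = (\<Sum>u\<in>N. \<Sum>v\<in>N-{u}. p u * p v * \<beta> u v * (x u i * x v j))
    + (\<Sum>u\<in>N. (p u)\<^sup>2 * \<beta> u u * (x u i * x u j))"
proof -
  have "(\<Sum>v\<in>N. p u * p v * \<beta> u v * (x u i * x v j)) = (\<Sum>v\<in>N-{u}. p u * p v * \<beta> u v * (x u i * x v j))
    + (p u)\<^sup>2 * \<beta> u u * (x u i * x u j)" if "u \<in> N" for u
    using fin that by (simp add: sum.remove[of N u] power2_eq_square)
  then show ?thesis by (simp add: frac_edges_def sum.distrib)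
qed

text \<open>A unit row has a single nonzero entry, equal to its own square, so the omitted edge
  diagonal and the variance both vanish and the affine functional takes its intended value.\<close>

lemma penalized_integral:
  assumes f: "f ` N \<subseteq> {1..q}" and x: "\<And>u. u \<in> N \<Longrightarrow> x u = unit_row (f u)"
  shows "penalized q b K x = (\<Sum>i=1..q-1. \<Sum>j=i+1..q. 1 / (b i * b j) * frac_edges N p \<beta> x i j)
    + K * (\<Sum>i=1..q. (frac_mass N p x i - b i)\<^sup>2)"
proof -
  have "(\<Sum>u\<in>N. (p u)\<^sup>2 * \<beta> u u * (x u i * x u j)) = 0" if "i < j" for i j
    using x that by (intro sum.neutral) (auto simp: unit_row_def)
  moreover have "(\<Sum>u\<in>N. (p u)\<^sup>2 * (x u i - (x u i)\<^sup>2)) = 0" for i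
    using x by (intro sum.neutral) (auto simp: unit_row_def)
  ultimately show ?thesis
    unfolding penalized_def penalty_eq frac_edges_offdiag
    by (intro arg_cong2[of _ _ _ _ "(+)"] sum.cong) auto
qed

text \<open>With \<open>b\<close> equal to the masses of \<open>x\<close> the deviations vanish, and
  dropping the edge diagonal only lowers the density. The variances are at most the sums of
  \<open>\<delta> * p u * x u i\<close>, which add up to \<open>\<delta>\<close> over all classes
  and vertices.\<close>

lemma penalized_le:
  assumes x: "stochastic q x" and b: "\<And>i. i \<in> {1..q} \<Longrightarrow> b i = frac_mass N p x i"
    and pos: "\<And>i. i \<in> {1..q} \<Longrightarrow> 0 < b i"
    and K: "0 \<le> K" and \<delta>: "\<And>u. u \<in> N \<Longrightarrow> p u \<le> \<delta>"
  shows "penalized q b K x \<le> frac_density N p \<beta> q x + K * \<delta>"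
  unfolding penalized_def penalty_eq
proof (rule add_mono)
  show "(\<Sum>i=1..q-1. \<Sum>j=i+1..q. 1 / (b i * b j) *
        (\<Sum>u\<in>N. \<Sum>v\<in>N-{u}. p u * p v * \<beta> u v * (x u i * x v j))) \<le> frac_density N p \<beta> q x"
    unfolding frac_density_def
  proof (intro sum_mono)
    fix i j assume "i \<in> {1..q-1}" "j \<in> {i+1..q}"
    then have ij: "i \<in> {1..q}" "j \<in> {1..q}" by auto
    have "0 \<le> (\<Sum>u\<in>N. (p u)\<^sup>2 * \<beta> u u * (x u i * x u j))"
      by (intro sum_nonneg mult_nonneg_nonneg) (use ij \<beta> stochastic_bounds[OF x] in auto)
    then show "1 / (b i * b j) * (\<Sum>u\<in>N. \<Sum>v\<in>N-{u}. p u * p v * \<beta> u v * (x u i * x v j))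
      \<le> 1 / (frac_mass N p x i * frac_mass N p x j) * frac_edges N p \<beta> x i j"
      unfolding frac_edges_offdiag b[OF ij(1), symmetric] b[OF ij(2), symmetric]
      using pos[OF ij(1)] pos[OF ij(2)] by (intro mult_left_mono) auto
  qed
  have "(\<Sum>i=1..q. (frac_mass N p x i - b i)\<^sup>2 + (\<Sum>u\<in>N. (p u)\<^sup>2 * (x u i - (x u i)\<^sup>2)))
    \<le> (\<Sum>i=1..q. \<Sum>u\<in>N. \<delta> * p u * x u i)"
  proof (intro sum_mono)
    fix i assume i: "i \<in> {1..q}"
    have "(p u)\<^sup>2 * (x u i - (x u i)\<^sup>2) \<le> \<delta> * p u * x u i" if u: "u \<in> N" for u
    proof -
      have "(p u)\<^sup>2 * (x u i - (x u i)\<^sup>2) \<le> (p u)\<^sup>2 * x u i" by (intro mult_left_mono) auto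
      also have "\<dots> \<le> \<delta> * p u * x u i"
        unfolding power2_eq_square using p_nonneg[OF u] \<delta>[OF u] stochastic_bounds[OF x u i]
        by (intro mult_right_mono) auto
      finally show ?thesis .
    qed
    then show "(frac_mass N p x i - b i)\<^sup>2 + (\<Sum>u\<in>N. (p u)\<^sup>2 * (x u i - (x u i)\<^sup>2)) \<le> (\<Sum>u\<in>N. \<delta> * p u * x u i)"
      using b[OF i] by (simp add: sum_mono)
  qed
  also have "\<dots> = (\<Sum>u\<in>N. \<Sum>i=1..q. \<delta> * p u * x u i)" by (rule sum.swap)
  also have "\<dots> = \<delta>" using x p_sum by (simp add: stochastic_def flip: sum_distrib_left)
  finally show "K * (\<Sum>i=1..q. (frac_mass N p x i - b i)\<^sup>2 + (\<Sum>u\<in>N. (p u)\<^sup>2 * (x u i - (x u i)\<^sup>2))) \<le> K * \<delta>"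
    using K by (rule mult_left_mono)
qed

lemma frac_density_le:
  assumes x: "stochastic q x" and pos: "\<And>i. i \<in> {1..q} \<Longrightarrow> 0 < frac_mass N p x i"
  shows "frac_density N p \<beta> q x \<le> (real q)\<^sup>2"
proof -
  have "frac_density N p \<beta> q x \<le> (\<Sum>i=1..q-1. \<Sum>j=i+1..q. 0) + (real q)\<^sup>2 * 1"
    unfolding frac_density_def
    using frac_edges_le[OF x] pos by (intro pair_sum_le) (auto simp: divide_le_eq)
  then show ?thesis by simp
qed

end

section \<open>Rounding with a uniform error\<close>

text \<open>Here \<open>\<delta>\<close> is fixed before the vertex set and the weights, so one
  threshold serves all late members of a graph sequence.\<close>

lemma integral_rounding:
  fixes q :: nat and c \<epsilon> :: real
  assumes q: "1 \<le> q" and c: "0 < c" "c < 1 / real q" and \<epsilon>: "0 < \<epsilon>"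
  obtains \<delta> where "0 < \<delta>"
    and "\<And>N p \<beta> x. vertex_weights N p \<beta> \<Longrightarrow> (\<And>u. u \<in> N \<Longrightarrow> p u \<le> \<delta>) \<Longrightarrow>
      vertex_weights.stochastic N q x \<Longrightarrow> (\<And>i. i \<in> {1..q} \<Longrightarrow> c \<le> frac_mass N p x i) \<Longrightarrow>
      \<exists>f. f ` N \<subseteq> {1..q} \<and> (\<forall>i\<in>{1..q}. c \<le> frac_mass N p (\<lambda>u. unit_row (f u)) i) \<and>
        frac_density N p \<beta> q (\<lambda>u. unit_row (f u)) \<le> frac_density N p \<beta> q x + \<epsilon>"
proof -
  \<comment> \<open>The error is split into thirds: mixing costs \<open>L * (2 * \<eta>)\<close>,
    restoring the denominators after rounding costs \<open>L * \<kappa>\<close>, and the altered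
    diagonal costs \<open>K * \<delta>\<close>. \<open>L\<close> is the constant of
    \<open>ratio_perturb\<close> summed over the pairs of classes.\<close>
  define L where "L = (real q)\<^sup>2 * (3 / c\<^sup>2)"
  have L: "0 < L" using q c by (simp add: L_def)
  define \<eta> where "\<eta> = min 1 (\<epsilon> / (6 * L))"
  have \<eta>: "0 < \<eta>" "\<eta> \<le> 1" "L * (2 * \<eta>) \<le> \<epsilon> / 3"
    using L \<epsilon> by (auto simp: \<eta>_def min_def field_simps)
  define g where "g = 1 / real q - c"
  have g: "0 < g" using c by (simp add: g_def)
  \<comment> \<open>\<open>\<kappa>\<close> is the permitted error of the rounded masses: no more
    than the slack \<open>\<eta> * g\<close> gained by mixing, so that the bound \<open>c\<close>
    survives.\<close>
  define \<kappa> where "\<kappa> = min (\<eta> * g) (\<epsilon> / (3 * L))"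
  have \<kappa>: "0 < \<kappa>" "\<kappa> \<le> \<eta> * g" "L * \<kappa> \<le> \<epsilon> / 3"
    using L \<epsilon> \<eta> g by (auto simp: \<kappa>_def min_def field_simps)
  \<comment> \<open>The sum of squared deviations will be at most
    \<open>(real q)\<^sup>2 / K + \<delta>\<close>. \<open>K\<close> and \<open>\<delta>\<close>
    give each summand half of \<open>\<kappa>\<^sup>2\<close>.\<close>
  define K where "K = 2 * (real q)\<^sup>2 / \<kappa>\<^sup>2"
  have K: "0 < K" "(real q)\<^sup>2 / K = \<kappa>\<^sup>2 / 2" using \<kappa> q by (auto simp: K_def)
  define \<delta> where "\<delta> = min (\<kappa>\<^sup>2 / 2) (\<epsilon> / (3 * K))"
  have \<delta>: "0 < \<delta>" "\<delta> \<le> \<kappa>\<^sup>2 / 2" "K * \<delta> \<le> \<epsilon> / 3"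
    using K \<epsilon> \<kappa> by (auto simp: \<delta>_def min_def field_simps)
  show thesis
  proof (rule that[OF \<delta>(1)])
    fix N p \<beta> and x :: "nat \<Rightarrow> nat \<Rightarrow> real"
    assume vw: "vertex_weights N p \<beta>" and p\<delta>: "\<And>u. u \<in> N \<Longrightarrow> p u \<le> \<delta>"
      and x: "vertex_weights.stochastic N q x" and mass: "\<And>i. i \<in> {1..q} \<Longrightarrow> c \<le> frac_mass N p x i"
    interpret vertex_weights N p \<beta> by (rule vw)
    define y where "y = (\<lambda>u i. (1 - \<eta>) * x u i + \<eta> / real q)"
    have c': "c \<le> 1 / real q" using c by simp
    note mix = frac_density_mix[OF x less_imp_le[OF \<eta>(1)] \<eta>(2) q c(1) c' mass, folded y_def g_def]
    have y: "stochastic q y" using mix(1) by simp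
    have lower: "c + \<eta> * g \<le> frac_mass N p y i" if "i \<in> {1..q}" for i using mix(2) that by simp
    have pos: "0 < frac_mass N p y i" if "i \<in> {1..q}" for i
      using lower[OF that] c mult_pos_pos[OF \<eta>(1) g] by linarith
    have dy: "frac_density N p \<beta> q y \<le> frac_density N p \<beta> q x + \<epsilon> / 3"
      using mix(3) \<eta>(3) unfolding L_def mult.assoc by linarith
    \<comment> \<open>Freezing at the masses of \<open>y\<close>, not of \<open>x\<close>, makes the
      penalty start without deviation and leaves the slack for the rounded masses.\<close>
    define b where "b = frac_mass N p y"
    obtain f where f: "f ` N \<subseteq> {1..q}"
      and fy: "penalized q b K (\<lambda>u. if u \<in> N then unit_row (f u) else y u) \<le> penalized q b K y"
      using multiaffine_rounding[OF fin subset_refl finite_atLeastAtMost multiaffine_penalized, of q y b K] y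
      by (auto simp: stochastic_def)
    define X where "X = (\<lambda>u. unit_row (f u))"
    have X: "stochastic q X"
      using f by (auto simp: stochastic_def X_def unit_row_def image_subset_iff sum.delta)
    \<comment> \<open>Rounding leaves rows outside \<open>N\<close> alone, but the functional reads
      only rows in \<open>N\<close>.\<close>
    have "penalized q b K (\<lambda>u. if u \<in> N then unit_row (f u) else y u) = penalized q b K X"
      unfolding penalized_def X_def by (intro arg_cong2[of _ _ _ _ "(+)"] arg_cong2[of _ _ _ _ "(*)"] sum.cong) auto
    then have "penalized q b K X \<le> frac_density N p \<beta> q y + K * \<delta>"
      using fy penalized_le[OF y, of b K \<delta>] pos p\<delta> K by (simp add: b_def)
    moreover have "penalized q b K X = (\<Sum>i=1..q-1. \<Sum>j=i+1..q. 1 / (b i * b j) * frac_edges N p \<beta> X i j)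
        + K * (\<Sum>i=1..q. (frac_mass N p X i - b i)\<^sup>2)" (is "_ = ?E + K * ?V")
      by (rule penalized_integral[OF f]) (simp add: X_def)
    ultimately have EV: "?E + K * ?V \<le> frac_density N p \<beta> q y + K * \<delta>" by simp
    have E: "0 \<le> ?E"
      by (intro sum_nonneg mult_nonneg_nonneg) (use pos frac_edges_nonneg[OF X] in \<open>auto simp: b_def less_imp_le\<close>)
    have V: "0 \<le> ?V" by (intro sum_nonneg) auto
    \<comment> \<open>The rounded frozen density cannot be negative, so the penalty alone is bounded
      by the starting value, whose density part is at most q squared.\<close>
    have "K * ?V \<le> (real q)\<^sup>2 + K * \<delta>" using EV E frac_density_le[OF y pos] by linarith
    then have "?V \<le> (real q)\<^sup>2 / K + \<delta>" using K by (simp add: field_simps)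
    then have V\<kappa>: "?V \<le> \<kappa>\<^sup>2" using K \<delta> by simp
    have close: "\<bar>frac_mass N p X i - b i\<bar> \<le> \<kappa>" if "i \<in> {1..q}" for i
    proof -
      have "(frac_mass N p X i - b i)\<^sup>2 \<le> ?V" using that by (intro member_le_sum) auto
      then show ?thesis using V\<kappa> \<kappa> by (intro abs_le_square_iff[THEN iffD2, of _ \<kappa>, simplified abs_of_pos[OF \<kappa>(1)]]) linarith
    qed
    have mX: "c \<le> frac_mass N p X i" if "i \<in> {1..q}" for i
      using close[OF that] lower[OF that] \<kappa>(2) by (simp add: b_def)
    have "frac_density N p \<beta> q X \<le> ?E + (real q)\<^sup>2 * (3 / c\<^sup>2 * \<kappa>)"
      unfolding frac_density_def
    proof (rule pair_sum_le)
      fix i j assume ij: "i \<in> {1..q}" "j \<in> {1..q}"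
      have "c \<le> b k" if "k \<in> {1..q}" for k
        using lower[OF that] mult_pos_pos[OF \<eta>(1) g] by (simp add: b_def)
      then show "1 / (frac_mass N p X i * frac_mass N p X j) * frac_edges N p \<beta> X i j
        \<le> 1 / (b i * b j) * frac_edges N p \<beta> X i j + 3 / c\<^sup>2 * \<kappa>"
        using ij c mX close \<kappa>(1) frac_mass_le_1[OF X] frac_mass_le_1[OF y] frac_edges_nonneg[OF X] frac_edges_le[OF X]
        by (intro ratio_perturb) (auto simp: b_def)
    qed (use \<kappa> c in auto)
    also have "\<dots> \<le> frac_density N p \<beta> q y + K * \<delta> + \<epsilon> / 3"
      using EV V K \<kappa>(3) mult_nonneg_nonneg[OF less_imp_le[OF K(1)] V] unfolding L_def mult.assoc by linarith
    also have "\<dots> \<le> frac_density N p \<beta> q x + \<epsilon>" using dy \<delta>(3) by linarith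
    finally show "\<exists>f. f ` N \<subseteq> {1..q} \<and> (\<forall>i\<in>{1..q}. c \<le> frac_mass N p (\<lambda>u. unit_row (f u)) i) \<and>
        frac_density N p \<beta> q (\<lambda>u. unit_row (f u)) \<le> frac_density N p \<beta> q x + \<epsilon>"
      using f mX by (intro exI[of _ f]) (auto simp: X_def)
  qed
qed

subsection \<open>Step graphons\<close>

abbreviation rel_weight :: "wgraph \<Rightarrow> nat \<Rightarrow> real" where
  "rel_weight G u \<equiv> vweight G u / total_weight G"

lemma total_weight_pos:
  assumes "weighted_graph G" shows "0 < total_weight G"
  using assms unfolding total_weight_def set_weight_def
  by (intro sum_pos) (auto simp: weighted_graph_def verts_def)

lemma rel_weight_pos: "weighted_graph G \<Longrightarrow> u \<in> verts G \<Longrightarrow> 0 < rel_weight G u"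
  using total_weight_pos by (auto simp: weighted_graph_def)

lemma sum_rel_weight: "weighted_graph G \<Longrightarrow> (\<Sum>u\<in>verts G. rel_weight G u) = 1"
  using total_weight_pos[of G] by (simp add: total_weight_def set_weight_def flip: sum_divide_distrib)

lemma vertex_weights_graph:
  assumes "weighted_graph G" shows "vertex_weights (verts G) (rel_weight G) (eweight G)"
proof
  show "finite (verts G)" by (simp add: verts_def)
  show "0 \<le> rel_weight G u" if "u \<in> verts G" for u using rel_weight_pos[OF assms that] by simp
qed (use assms sum_rel_weight in \<open>auto simp: weighted_graph_def\<close>)

lemma step_end_Suc: "step_end G (Suc i) = step_end G i + rel_weight G (Suc i)"
  by (simp add: step_end_def set_weight_def add_divide_distrib)

lemma step_end_0: "step_end G 0 = 0"
  by (simp add: step_end_def set_weight_def)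

lemma step_end_nverts: "weighted_graph G \<Longrightarrow> step_end G (nverts G) = 1"
  using total_weight_pos[of G] by (simp add: step_end_def total_weight_def verts_def)

lemma step_end_mono:
  assumes G: "weighted_graph G" and "i \<le> j" "j \<le> nverts G"
  shows "step_end G i \<le> step_end G j"
  using assms(2,3)
proof (induction j rule: dec_induct)
  case (step j)
  then show ?case using rel_weight_pos[OF G, of "Suc j"] by (simp add: step_end_Suc verts_def)
qed simp

lemma mem_step_interval:
  "u \<in> verts G \<Longrightarrow> x \<in> step_interval G u \<longleftrightarrow>
    (x \<le> step_end G u \<and> (if u = 1 then 0 \<le> x else step_end G (u - 1) < x))"
  by (auto simp: step_interval_def)

lemma step_interval_lebesgue: "step_interval G u \<in> sets lebesgue"
  by (simp add: step_interval_def)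

lemma measure_step_interval:
  assumes G: "weighted_graph G" and u: "u \<in> verts G"
  shows "measure lebesgue (step_interval G u) = rel_weight G u"
proof -
  obtain i where i: "u = Suc i" using u by (cases u) (auto simp: verts_def)
  show ?thesis
    using rel_weight_pos[OF G u] step_end_Suc[of G i] step_end_0[of G] unfolding i
    by (cases i) (simp_all add: step_interval_def)
qed

lemma disjoint_step_intervals:
  assumes G: "weighted_graph G" shows "disjoint_family_on (step_interval G) (verts G)"
proof -
  have "step_interval G u \<inter> step_interval G v = {}" if "u < v" "u \<in> verts G" "v \<in> verts G" for u v
  proof -
    have "u \<le> v - 1" "v - 1 \<le> nverts G" "v \<noteq> 1" using that by (auto simp: verts_def)
    then show ?thesis
      using step_end_mono[OF G, of u "v - 1"] that by (auto simp: mem_step_interval)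
  qed
  then show ?thesis unfolding disjoint_family_on_def by (metis Int_commute nat_neq_iff)
qed

lemma Union_step_intervals:
  assumes G: "weighted_graph G" shows "(\<Union>u\<in>verts G. step_interval G u) = {0..1}"
proof (intro set_eqI iffI)
  fix x assume "x \<in> (\<Union>u\<in>verts G. step_interval G u)"
  then obtain u where u: "u \<in> verts G" "x \<in> step_interval G u" by blast
  have "step_end G u \<le> 1" "0 \<le> step_end G (u - 1)"
    using step_end_mono[OF G, of u "nverts G"] step_end_mono[OF G, of 0 "u - 1"] u
    by (auto simp: step_end_nverts[OF G] step_end_0 verts_def)
  then show "x \<in> {0..1}" using u by (auto simp: mem_step_interval split: if_splits)
next
  fix x :: real assume x: "x \<in> {0..1}"
  \<comment> \<open>The first right endpoint that is not below \<open>x\<close> identifies its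
    interval. The condition \<open>1 \<le> u\<close> matters at \<open>x = 0\<close>, where
    \<open>step_end G 0 = 0\<close> would otherwise select the nonexistent vertex 0.\<close>
  define u where "u = (LEAST u. 1 \<le> u \<and> x \<le> step_end G u)"
  have n: "1 \<le> nverts G \<and> x \<le> step_end G (nverts G)"
    using x G by (simp add: step_end_nverts weighted_graph_def)
  have u: "1 \<le> u \<and> x \<le> step_end G u" unfolding u_def by (rule LeastI[of _ "nverts G"]) (rule n)
  moreover have "u \<le> nverts G" unfolding u_def by (rule Least_le) (rule n)
  moreover have "step_end G (u - 1) < x" if "u \<noteq> 1"
  proof -
    have "u - 1 < u" using u by simp
    then have "\<not> (1 \<le> u - 1 \<and> x \<le> step_end G (u - 1))" unfolding u_def by (rule not_less_Least)
    then show ?thesis using u that by auto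
  qed
  ultimately have "u \<in> verts G" "x \<in> step_interval G u"
    using x by (auto simp: mem_step_interval verts_def)
  then show "x \<in> (\<Union>u\<in>verts G. step_interval G u)" by blast
qed

lemma step_interval_unit_measurable:
  "weighted_graph G \<Longrightarrow> u \<in> verts G \<Longrightarrow> step_interval G u \<in> unit_measurable_sets"
  using Union_step_intervals[of G] by (auto simp: unit_measurable_sets_def step_interval_lebesgue)

lemma finite_verts: "finite (verts G)"
  by (simp add: verts_def)

lemma step_graphon_kernel:
  assumes G: "weighted_graph G" shows "unit_kernel (step_graphon G)"
  unfolding unit_kernel_def
proof (intro conjI ballI)
  have "(\<lambda>(x, y). step_graphon G x y) = (\<lambda>z. \<Sum>i\<in>verts G. \<Sum>j\<in>verts G.
      eweight G i j * indicator (step_interval G i \<times> step_interval G j) z)"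
    by (simp add: step_graphon_def fun_eq_iff indicator_times mult.assoc)
  moreover have "step_interval G i \<times> step_interval G j \<in> sets unit_square_measure"
    if "i \<in> verts G" "j \<in> verts G" for i j
    using step_interval_unit_measurable[OF G] that
    by (auto simp: unit_measurable_sets_def sets_restrict_space_iff Times_lebesgue)
  ultimately show "(\<lambda>(x, y). step_graphon G x y) \<in> borel_measurable unit_square_measure"
    by (simp only:) (intro borel_measurable_sum borel_measurable_times borel_measurable_indicator
        borel_measurable_const, auto)
  fix x y :: real assume xy: "x \<in> {0..1}" "y \<in> {0..1}"
  have one: "(\<Sum>i\<in>verts G. indicator (step_interval G i) z) = (1::real)" if "z \<in> {0..1}" for z
    using indicator_UN_disjoint[OF finite_verts disjoint_step_intervals[OF G], of z] that
    unfolding Union_step_intervals[OF G] by simp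
  have e: "0 \<le> eweight G i j" "eweight G i j \<le> 1" if "i \<in> verts G" "j \<in> verts G" for i j
    using G that by (auto simp: weighted_graph_def)
  have "0 \<le> step_graphon G x y"
    unfolding step_graphon_def using e by (intro sum_nonneg mult_nonneg_nonneg) auto
  moreover have "step_graphon G x y \<le> (\<Sum>i\<in>verts G. \<Sum>j\<in>verts G.
      1 * indicator (step_interval G i) x * indicator (step_interval G j) y)"
    unfolding step_graphon_def using e by (intro sum_mono mult_right_mono) auto
  moreover have "\<dots> = 1" using one xy by (simp flip: sum_product)
  ultimately show "\<bar>step_graphon G x y\<bar> \<le> 1" by simp
qed

lemma cut_integral_step_graphon:
  assumes G: "weighted_graph G" and S: "S \<in> unit_measurable_sets" and T: "T \<in> unit_measurable_sets"
  shows "cut_integral (step_graphon G) S T = (\<Sum>u\<in>verts G. \<Sum>v\<in>verts G.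
    eweight G u v * (measure lebesgue (S \<inter> step_interval G u) * measure lebesgue (T \<inter> step_interval G v)))"
proof -
  interpret finite_measure unit_square_measure by (rule finite_measure_unit_square)
  let ?R = "\<lambda>u v. (S \<inter> step_interval G u) \<times> (T \<inter> step_interval G v)"
  have R: "?R u v \<in> sets lebesgue" "?R u v \<subseteq> {0..1} \<times> {0..1}" for u v
    using S T step_interval_lebesgue by (auto simp: unit_measurable_sets_def intro!: Times_lebesgue)
  then have Q: "?R u v \<in> sets unit_square_measure" for u v
    by (simp add: sets_restrict_space_iff)
  have "cut_integral (step_graphon G) S T = (LINT z | unit_square_measure.
      (\<Sum>u\<in>verts G. \<Sum>v\<in>verts G. eweight G u v * indicator (?R u v) z))"
    unfolding cut_integral_eq[OF S T]
    by (intro Bochner_Integration.integral_cong refl)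
      (simp add: step_graphon_def indicator_times indicator_inter_arith sum_distrib_left case_prod_unfold ac_simps)
  also have "\<dots> = (\<Sum>u\<in>verts G. \<Sum>v\<in>verts G. eweight G u v * measure unit_square_measure (?R u v))"
    using Q by (simp add: emeasure_eq_measure Int_absorb2[OF R(2)])
  also have "\<dots> = (\<Sum>u\<in>verts G. \<Sum>v\<in>verts G.
    eweight G u v * (measure lebesgue (S \<inter> step_interval G u) * measure lebesgue (T \<inter> step_interval G v)))"
  proof -
    have "S \<inter> step_interval G u \<in> sets lebesgue" "T \<inter> step_interval G u \<in> sets lebesgue" for u
      using S T step_interval_lebesgue by (auto simp: unit_measurable_sets_def)
    then have "measure unit_square_measure (?R u v)
        = measure lebesgue (S \<inter> step_interval G u) * measure lebesgue (T \<inter> step_interval G v)" for u v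
      by (subst measure_restrict_space) (use R in \<open>simp_all add: measure_lebesgue_Times\<close>)
    then show ?thesis by simp
  qed
  finally show ?thesis .
qed

section \<open>Partitions of the unit interval as fractional vertex partitions\<close>

text \<open>Used in both directions: a class is cut up by the step intervals to recover its mass,
  and a step interval is cut up by the classes to recover row sum 1.\<close>

lemma measure_split:
  assumes "finite K" "disjoint_family_on D K" "(\<Union>k\<in>K. D k) = {0..1}"
    and "\<And>k. k \<in> K \<Longrightarrow> D k \<in> sets lebesgue" and B: "B \<in> unit_measurable_sets"
  shows "measure lebesgue B = (\<Sum>k\<in>K. measure lebesgue (B \<inter> D k))"
proof -
  have sub: "measure lebesgue B = measure lebesgue (\<Union>k\<in>K. B \<inter> D k)"
    using assms(3) B by (intro arg_cong[of _ _ "measure _"]) (auto simp: unit_measurable_sets_def)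
  have "emeasure lebesgue (B \<inter> D k) \<noteq> \<infinity>" if "k \<in> K" for k
  proof -
    have "B \<inter> D k \<in> lmeasurable"
      using assms(4)[OF that] B by (intro bounded_set_imp_lmeasurable)
        (auto simp: unit_measurable_sets_def intro: bounded_subset[of "{0..1}"])
    then show ?thesis by (simp add: fmeasurable_def less_top del: emeasure_completion)
  qed
  then show ?thesis
    unfolding sub using assms
    by (intro measure_finite_Union) (auto simp: unit_measurable_sets_def disjoint_family_on_def)
qed

text \<open>The fraction of the interval of vertex \<open>u\<close> that lies in class
  \<open>i\<close>.\<close>

abbreviation occupancy :: "wgraph \<Rightarrow> (nat \<Rightarrow> real set) \<Rightarrow> nat \<Rightarrow> nat \<Rightarrow> real" where
  "occupancy G S u i \<equiv> measure lebesgue (S i \<inter> step_interval G u) / rel_weight G u"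

lemma frac_mass_occupancy:
  assumes G: "weighted_graph G" and S: "S i \<in> unit_measurable_sets"
  shows "frac_mass (verts G) (rel_weight G) (occupancy G S) i = measure lebesgue (S i)"
proof -
  have "frac_mass (verts G) (rel_weight G) (occupancy G S) i
      = (\<Sum>u\<in>verts G. measure lebesgue (S i \<inter> step_interval G u))"
    unfolding frac_mass_def
  proof (intro sum.cong refl)
    fix u assume "u \<in> verts G"
    have "p * (m / p) = m" if "0 < p" for p m :: real using that by simp
    from this[OF rel_weight_pos[OF G \<open>u \<in> verts G\<close>]]
    show "rel_weight G u * occupancy G S u i = measure lebesgue (S i \<inter> step_interval G u)" .
  qed
  also have "\<dots> = measure lebesgue (S i)"
    using measure_split[OF finite_verts disjoint_step_intervals[OF G] Union_step_intervals[OF G]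
      step_interval_lebesgue S] by simp
  finally show ?thesis .
qed

text \<open>There is no error term: a step graphon is constant on blocks, so its integrals see only
  how much of each interval each class occupies. The diagonal blocks account for the terms
  \<open>u = v\<close> in \<open>frac_edges\<close>.\<close>

lemma frac_density_occupancy:
  assumes G: "weighted_graph G" and S: "\<And>i. i \<in> {1..q} \<Longrightarrow> S i \<in> unit_measurable_sets"
  shows "frac_density (verts G) (rel_weight G) (eweight G) q (occupancy G S) = partition_density q (step_graphon G) S"
  unfolding frac_density_def partition_density_def
proof (intro sum.cong refl)
  fix i j assume "i \<in> {1..q-1}" "j \<in> {i+1..q}"
  then have ij: "S i \<in> unit_measurable_sets" "S j \<in> unit_measurable_sets" using S by auto
  have "frac_edges (verts G) (rel_weight G) (eweight G) (occupancy G S) i j = cut_integral (step_graphon G) (S i) (S j)"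
    unfolding frac_edges_def cut_integral_step_graphon[OF G ij]
  proof (intro sum.cong refl)
    fix u v assume uv: "u \<in> verts G" "v \<in> verts G"
    have "p * r * e * (a / p * (b / r)) = e * (a * b)" if "0 < p" "0 < r" for p r e a b :: real
      using that by simp
    from this[OF rel_weight_pos[OF G uv(1)] rel_weight_pos[OF G uv(2)]]
    show "rel_weight G u * rel_weight G v * eweight G u v * (occupancy G S u i * occupancy G S v j)
      = eweight G u v * (measure lebesgue (S i \<inter> step_interval G u) * measure lebesgue (S j \<inter> step_interval G v))" .
  qed
  then show "1 / (frac_mass (verts G) (rel_weight G) (occupancy G S) i * frac_mass (verts G) (rel_weight G) (occupancy G S) j) *
      frac_edges (verts G) (rel_weight G) (eweight G) (occupancy G S) i j
    = 1 / (measure lebesgue (S i) * measure lebesgue (S j)) * cut_integral (step_graphon G) (S i) (S j)"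
    unfolding frac_mass_occupancy[of G S, OF G ij(1)] frac_mass_occupancy[of G S, OF G ij(2)] by simp
qed

lemma stochastic_occupancy:
  assumes G: "weighted_graph G" and S: "S \<in> unit_balanced_partitions q c"
  shows "vertex_weights.stochastic (verts G) q (occupancy G S)"
  unfolding vertex_weights.stochastic_def[OF vertex_weights_graph[OF G]]
proof (intro ballI conjI)
  fix u assume u: "u \<in> verts G"
  show "0 \<le> occupancy G S u i" for i by (rule divide_nonneg_pos[OF measure_nonneg rel_weight_pos[OF G u]])
  have *: "(\<Sum>i=1..q. measure lebesgue (S i \<inter> step_interval G u)) = measure lebesgue (step_interval G u)"
    using measure_split[of "{1..q}" S "step_interval G u"] S step_interval_unit_measurable[OF G u]
    by (simp add: unit_balanced_partitions_def Int_commute)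
  show "(\<Sum>i=1..q. occupancy G S u i) = 1"
    unfolding sum_divide_distrib[symmetric] * measure_step_interval[OF G u]
    by (rule divide_self[OF less_imp_neq[OF rel_weight_pos[OF G u], symmetric]])
qed

section \<open>Vertex partitions, partitions of the unit interval and labellings\<close>

definition graph_density :: "nat \<Rightarrow> wgraph \<Rightarrow> (nat \<Rightarrow> nat set) \<Rightarrow> real" where
  "graph_density q G V = (\<Sum>i=1..q-1. \<Sum>j=i+1..q.
     1 / (set_weight G (V i) * set_weight G (V j)) * cut_weight G (V i) (V j))"

lemma frac_density_cong:
  assumes "\<And>u i. u \<in> N \<Longrightarrow> i \<in> {1..q} \<Longrightarrow> x u i = y u i"
  shows "frac_density N p \<beta> q x = frac_density N p \<beta> q y"
  unfolding frac_density_def frac_mass_def frac_edges_def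
  by (intro sum.cong refl arg_cong2[of _ _ _ _ "(*)"] arg_cong2[of _ _ _ _ "(/)"]) (use assms in auto)

lemma sum_indicator_verts:
  fixes f :: "nat \<Rightarrow> real"
  assumes "A \<subseteq> verts G"
  shows "(\<Sum>u\<in>verts G. indicator A u * f u) = sum f A"
  using assms by (intro sum.mono_neutral_cong_right) (auto simp: finite_verts)

lemma frac_mass_indicator:
  assumes "V i \<subseteq> verts G"
  shows "frac_mass (verts G) (rel_weight G) (\<lambda>u i. indicator (V i) u) i = set_weight G (V i) / total_weight G"
  unfolding frac_mass_def set_weight_def sum_divide_distrib sum_indicator_verts[OF assms, symmetric]
  by (intro sum.cong refl) simp

text \<open>The density is invariant under scaling: relative weights divide edge weights and
  products of class weights alike by the square of the total weight.\<close>

lemma graph_density_eq_frac_density: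
  assumes G: "weighted_graph G" and V: "\<And>i. i \<in> {1..q} \<Longrightarrow> V i \<subseteq> verts G"
  shows "graph_density q G V = frac_density (verts G) (rel_weight G) (eweight G) q (\<lambda>u i. indicator (V i) u)"
  unfolding graph_density_def frac_density_def
proof (intro sum.cong refl)
  fix i j assume "i \<in> {1..q-1}" "j \<in> {i+1..q}"
  then have ij: "V i \<subseteq> verts G" "V j \<subseteq> verts G" using V by auto
  let ?A = "total_weight G"
  have "frac_edges (verts G) (rel_weight G) (eweight G) (\<lambda>u i. indicator (V i) u) i j
      = (\<Sum>u\<in>verts G. indicator (V i) u * (\<Sum>v\<in>verts G. indicator (V j) v * (vweight G u * vweight G v * eweight G u v / ?A\<^sup>2)))"
    unfolding frac_edges_def sum_distrib_left
    by (intro sum.cong refl) (simp add: power2_eq_square)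
  also have "\<dots> = cut_weight G (V i) (V j) / ?A\<^sup>2"
    unfolding sum_indicator_verts[OF ij(1)] sum_indicator_verts[OF ij(2)] cut_weight_def sum_divide_distrib ..
  finally have "frac_edges (verts G) (rel_weight G) (eweight G) (\<lambda>u i. indicator (V i) u) i j
    = cut_weight G (V i) (V j) / ?A\<^sup>2" .
  then show "1 / (set_weight G (V i) * set_weight G (V j)) * cut_weight G (V i) (V j)
    = 1 / (frac_mass (verts G) (rel_weight G) (\<lambda>u i. indicator (V i) u) i *
           frac_mass (verts G) (rel_weight G) (\<lambda>u i. indicator (V i) u) j) *
      frac_edges (verts G) (rel_weight G) (eweight G) (\<lambda>u i. indicator (V i) u) i j"
    unfolding frac_mass_indicator[of V, OF ij(1)] frac_mass_indicator[of V, OF ij(2)]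
    using total_weight_pos[OF G] by (simp add: power2_eq_square)
qed

text \<open>The easy comparison, without loss: unions of whole step intervals have 0-1 occupancies,
  so every graph partition is a partition of the unit interval with the same density for the step
  graphon.\<close>

lemma step_partition:
  assumes G: "weighted_graph G" and V: "V \<in> balanced_partitions q c G"
  defines "S \<equiv> \<lambda>i. \<Union>u\<in>V i. step_interval G u"
  shows "S \<in> unit_balanced_partitions q c" "partition_density q (step_graphon G) S = graph_density q G V"
proof -
  have V': "\<And>i. i \<in> {1..q} \<Longrightarrow> V i \<subseteq> verts G" "disjoint_family_on V {1..q}" "(\<Union>i\<in>{1..q}. V i) = verts G"
    "\<And>i. i \<in> {1..q} \<Longrightarrow> set_weight G (V i) / total_weight G \<ge> c"
    using V unfolding balanced_partitions_def by (blast, blast, blast, blast)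
  have meas: "S i \<in> unit_measurable_sets" if "i \<in> {1..q}" for i
  proof -
    have "finite (V i)" using V'(1)[OF that] finite_verts finite_subset by blast
    then show ?thesis
      using V'(1)[OF that] step_interval_unit_measurable[OF G] unfolding S_def unit_measurable_sets_def by blast
  qed
  have int: "S i \<inter> step_interval G u = (if u \<in> V i then step_interval G u else {})"
    if "i \<in> {1..q}" "u \<in> verts G" for i u
  proof (cases "u \<in> V i")
    case False
    have "step_interval G v \<inter> step_interval G u = {}" if v: "v \<in> V i" for v
    proof (rule disjoint_family_onD[OF disjoint_step_intervals[OF G]])
      show "v \<in> verts G" using V'(1)[OF \<open>i \<in> {1..q}\<close>] v by (rule subsetD)
      show "v \<noteq> u" using v False by auto
    qed (rule \<open>u \<in> verts G\<close>)
    then show ?thesis using False unfolding S_def by auto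
  qed (auto simp: S_def)
  have occ: "occupancy G S u i = indicator (V i) u" if "u \<in> verts G" "i \<in> {1..q}" for u i
    using int[OF that(2,1)] measure_step_interval[OF G that(1)] rel_weight_pos[OF G that(1)] by (auto simp: indicator_def)
  have "partition_density q (step_graphon G) S
      = frac_density (verts G) (rel_weight G) (eweight G) q (occupancy G S)"
    using frac_density_occupancy[of G q S, OF G meas] by simp
  also have "\<dots> = frac_density (verts G) (rel_weight G) (eweight G) q (\<lambda>u i. indicator (V i) u)"
    by (rule frac_density_cong) (rule occ)
  also have "\<dots> = graph_density q G V" using graph_density_eq_frac_density[of G q V, OF G V'(1)] by simp
  finally show "partition_density q (step_graphon G) S = graph_density q G V" .
  have U: "(\<Union>i\<in>{1..q}. S i) = {0..1}"
  proof -
    have "(\<Union>i\<in>{1..q}. S i) = (\<Union>u\<in>(\<Union>i\<in>{1..q}. V i). step_interval G u)" unfolding S_def by blast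
    then show ?thesis unfolding V'(3) Union_step_intervals[OF G] .
  qed
  have D: "disjoint_family_on S {1..q}"
    unfolding disjoint_family_on_def
  proof (intro ballI impI)
    fix i j assume ij: "i \<in> {1..q}" "j \<in> {1..q}" "i \<noteq> j"
    have "S i \<inter> step_interval G u = {}" if "u \<in> V j" for u
    proof -
      have "u \<in> verts G" "u \<notin> V i"
        using that V'(1)[OF ij(2)] disjoint_family_onD[OF V'(2) ij] by blast+
      then show ?thesis using int[OF ij(1)] by simp
    qed
    then show "S i \<inter> S j = {}" unfolding S_def by blast
  qed
  have "measure lebesgue (S i) = set_weight G (V i) / total_weight G" if "i \<in> {1..q}" for i
  proof -
    have "measure lebesgue (S i) = frac_mass (verts G) (rel_weight G) (occupancy G S) i"
      using frac_mass_occupancy[of G S, OF G meas[OF that]] by simp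
    also have "\<dots> = frac_mass (verts G) (rel_weight G) (\<lambda>u i. indicator (V i) u) i"
      unfolding frac_mass_def by (intro sum.cong refl) (use occ that in simp)
    finally show ?thesis using frac_mass_indicator[of V, OF V'(1)[OF that]] by simp
  qed
  moreover have "(\<Sum>i=1..q. measure lebesgue (S i)) = 1"
    using measure_split[OF _ D U, of "{0..1}"] meas by (simp add: unit_measurable_sets_def Int_absorb1)
  ultimately show "S \<in> unit_balanced_partitions q c"
    using U D meas V'(4) by (auto simp: unit_balanced_partitions_def unit_measurable_sets_def)
qed

lemma finite_balanced_partitions: "finite (balanced_partitions q c G)"
proof -
  have "balanced_partitions q c G \<subseteq> {1..q} \<rightarrow>\<^sub>E Pow (verts G)" by (auto simp: balanced_partitions_def)
  moreover have "finite ({1..q} \<rightarrow>\<^sub>E Pow (verts G))" by (intro finite_PiE) (auto simp: finite_verts)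
  ultimately show ?thesis by (rule finite_subset)
qed

lemma min_cut_density_eq: "min_cut_density q c G = Min (graph_density q G ` balanced_partitions q c G)"
  by (simp add: min_cut_density_def graph_density_def[abs_def])

text \<open>Turns the output of the rounding into an admissible competitor for the minimum. The
  classes form a restricted function because balanced partitions are extensional families.\<close>

lemma labelling_balanced:
  assumes G: "weighted_graph G" and c: "0 < c" and f: "f ` verts G \<subseteq> {1..q}"
    and mass: "\<And>i. i \<in> {1..q} \<Longrightarrow> c \<le> frac_mass (verts G) (rel_weight G) (\<lambda>u. unit_row (f u)) i"
  defines "V \<equiv> \<lambda>i\<in>{1..q}. {u \<in> verts G. f u = i}"
  shows "V \<in> balanced_partitions q c G"
    "graph_density q G V = frac_density (verts G) (rel_weight G) (eweight G) q (\<lambda>u. unit_row (f u))"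
proof -
  have sub: "V i \<subseteq> verts G" if "i \<in> {1..q}" for i using that by (auto simp: V_def)
  have row: "unit_row (f u) i = indicator (V i) u" if "u \<in> verts G" "i \<in> {1..q}" for u i
    using that by (auto simp: V_def unit_row_def)
  have m: "c \<le> set_weight G (V i) / total_weight G" if i: "i \<in> {1..q}" for i
  proof -
    have "frac_mass (verts G) (rel_weight G) (\<lambda>u. unit_row (f u)) i
        = frac_mass (verts G) (rel_weight G) (\<lambda>u i. indicator (V i) u) i"
      unfolding frac_mass_def by (intro sum.cong refl) (use row i in simp)
    then show ?thesis using mass[OF i] frac_mass_indicator[of V, OF sub[OF i]] by simp
  qed
  \<comment> \<open>Nonemptiness is not an extra demand on the rounding: an empty class would have
    mass 0, below \<open>c\<close>.\<close>
  have "V i \<noteq> {}" if "i \<in> {1..q}" for i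
    using m[OF that] c by (auto simp: set_weight_def)
  moreover have "disjoint_family_on V {1..q}" by (auto simp: disjoint_family_on_def V_def)
  moreover have "(\<Union>i\<in>{1..q}. V i) = verts G" using f by (auto simp: V_def)
  moreover have "V \<in> {1..q} \<rightarrow>\<^sub>E Pow (verts G)" by (auto simp: V_def)
  ultimately show "V \<in> balanced_partitions q c G" using m by (simp add: balanced_partitions_def)
  show "graph_density q G V = frac_density (verts G) (rel_weight G) (eweight G) q (\<lambda>u. unit_row (f u))"
    by (rule trans[OF graph_density_eq_frac_density[of G q V, OF G sub] frac_density_cong]) (simp_all add: row)
qed

text \<open>The step intervals of \<open>q\<close> vertices of equal weight are an exact
  equipartition. Together with a lower bound on the densities it gives the real infimum its usual
  meaning.\<close>

lemma unit_balanced_partitions_nonempty: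
  assumes q: "1 \<le> q" and c: "c \<le> 1 / real q"
  shows "unit_balanced_partitions q c \<noteq> {}"
proof -
  define G where "G = \<lparr>nverts = q, vweight = (\<lambda>_. 1), eweight = (\<lambda>_ _. 0)\<rparr>"
  have v: "verts G = {1..q}" by (simp add: verts_def G_def)
  have G: "weighted_graph G" using q by (simp add: weighted_graph_def G_def)
  have "rel_weight G u = 1 / real q" for u
    by (simp add: total_weight_def set_weight_def v) (simp add: G_def)
  then have m: "measure lebesgue (step_interval G u) = 1 / real q" if "u \<in> {1..q}" for u
    using measure_step_interval[OF G, of u] that by (simp add: v)
  have "step_interval G \<in> unit_balanced_partitions q c"
    using disjoint_step_intervals[OF G] Union_step_intervals[OF G] q c m
    by (simp add: unit_balanced_partitions_def v step_interval_lebesgue)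
  then show ?thesis by blast
qed

lemma partition_density_nonneg:
  assumes W: "graphon W" and S: "S \<in> unit_balanced_partitions q c"
  shows "0 \<le> partition_density q W S"
  unfolding partition_density_def
proof (intro sum_nonneg mult_nonneg_nonneg)
  fix i j assume "i \<in> {1..q-1}" "j \<in> {i+1..q}"
  then have ij: "S i \<in> unit_measurable_sets" "S j \<in> unit_measurable_sets"
    using unit_balanced_partition_measurable[OF S] by auto
  show "0 \<le> cut_integral W (S i) (S j)"
    unfolding cut_integral_eq[OF ij] using W
    by (intro integral_nonneg_AE AE_I2) (auto simp: graphon_def space_restrict_space)
qed auto

section \<open>Convergence of the minimum cut densities\<close>

text \<open>For \<open>q \<ge> 2\<close> the value \<open>c = 1 / real q\<close> would force all
  classes to have equal weight, which a graph may not permit: with two classes and an odd number of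
  equal vertex weights the minimum ranges over the empty set. Hence \<open>c_strict\<close>. A
  single class has full mass, so \<open>q = 1\<close> tolerates equality.\<close>

theorem proposition22:
  fixes q :: nat and c :: real
    and G :: "nat \<Rightarrow> wgraph" and W :: "real \<Rightarrow> real \<Rightarrow> real"
  assumes q_pos: "q \<ge> 1"
    and c_pos: "0 < c"
    and c_le: "c \<le> 1 / real q"
    and c_strict: "q \<ge> 2 \<Longrightarrow> c < 1 / real q"
    and graphs: "\<And>n. weighted_graph (G n)"
    and conv: "convergent_graphs G"
    and no_dominant:
      "(\<lambda>n. Max (vweight (G n) ` verts (G n)) / total_weight (G n)) \<longlonglongrightarrow> 0"
    and W: "graphon W"
    and limit: "(\<lambda>n. cut_dist (step_graphon (G n)) W) \<longlonglongrightarrow> 0"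
  shows "(\<lambda>n. min_cut_density q c (G n)) \<longlonglongrightarrow> graphon_cut_density q c W"
proof (cases "q = 1")
  \<comment> \<open>There are no pairs of classes, so both densities are 0. This case is separate
    because \<open>c = 1\<close> leaves no slack for mixing; only existence of a partition needs
    checking.\<close>
  case True
  have "min_cut_density q c (G n) = 0" for n
  proof -
    have "(\<lambda>i\<in>{1}. verts (G n)) \<in> balanced_partitions q c (G n)"
      using graphs[of n] c_le total_weight_pos[OF graphs[of n]] True
      by (auto simp: balanced_partitions_def disjoint_family_on_def total_weight_def weighted_graph_def verts_def)
    moreover have "graph_density q (G n) = (\<lambda>V. 0)" using True by (simp add: graph_density_def fun_eq_iff)
    ultimately have "graph_density q (G n) ` balanced_partitions q c (G n) = {0}" by auto
    then show ?thesis by (simp add: min_cut_density_eq)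
  qed
  moreover have "graphon_cut_density q c W = 0"
    using unit_balanced_partitions_nonempty[OF q_pos c_le] True
    by (simp add: graphon_cut_density_eq partition_density_def)
  ultimately show ?thesis by simp
next
  case False
  then have c: "c < 1 / real q" using q_pos c_strict by simp
  let ?Q = "unit_balanced_partitions q c" and ?\<mu> = "graphon_cut_density q c W"
  have bdd: "bdd_below (partition_density q W ` ?Q)"
    using partition_density_nonneg[OF W] by (intro bdd_belowI2[of _ 0])
  show ?thesis
  proof (rule LIMSEQ_I)
    fix r :: real assume r: "0 < r"
    \<comment> \<open>The upper estimate loses \<open>\<epsilon>\<close> three times: for a nearly
      optimal partition, for the cut distance and for rounding. The lower estimate loses it once, so
      a quarter of \<open>r\<close> leaves room for strictness.\<close>
    define \<epsilon> where "\<epsilon> = r / 4"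
    have \<epsilon>: "0 < \<epsilon>" using r by (simp add: \<epsilon>_def)
    \<comment> \<open>\<open>E\<close> is the factor by which the cut distance can be amplified in a
      partition density; distance below \<open>\<epsilon> / E\<close> therefore costs at most
      \<open>\<epsilon>\<close>.\<close>
    define E where "E = (real q / c)\<^sup>2"
    have E: "0 < E" using q_pos c_pos by (simp add: E_def)
    obtain \<delta> where \<delta>: "0 < \<delta>"
      and round: "\<And>N p \<beta> x. vertex_weights N p \<beta> \<Longrightarrow> (\<And>u. u \<in> N \<Longrightarrow> p u \<le> \<delta>) \<Longrightarrow>
        vertex_weights.stochastic N q x \<Longrightarrow> (\<And>i. i \<in> {1..q} \<Longrightarrow> c \<le> frac_mass N p x i) \<Longrightarrow>
        \<exists>f. f ` N \<subseteq> {1..q} \<and> (\<forall>i\<in>{1..q}. c \<le> frac_mass N p (\<lambda>u. unit_row (f u)) i) \<and>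
          frac_density N p \<beta> q (\<lambda>u. unit_row (f u)) \<le> frac_density N p \<beta> q x + \<epsilon>"
      by (rule integral_rounding[OF q_pos c_pos c \<epsilon>]) blast
    have "\<forall>\<^sub>F n in sequentially. Max (vweight (G n) ` verts (G n)) / total_weight (G n) < \<delta>"
      using order_tendstoD(2)[OF no_dominant \<delta>] .
    moreover have "\<forall>\<^sub>F n in sequentially. cut_dist (step_graphon (G n)) W < \<epsilon> / E"
      using order_tendstoD(2)[OF limit, of "\<epsilon> / E"] \<epsilon> E by simp
    ultimately have "\<forall>\<^sub>F n in sequentially. norm (min_cut_density q c (G n) - ?\<mu>) < r"
    proof eventually_elim
      case (elim n)
      let ?U = "step_graphon (G n)" and ?B = "balanced_partitions q c (G n)"
      note Gn = graphs[of n]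
      note close = partition_density_cut_dist[OF step_graphon_kernel[OF Gn] graphon_unit_kernel[OF W] c_pos elim(2), of _ q, folded E_def]
      have p\<delta>: "rel_weight (G n) u \<le> \<delta>" if "u \<in> verts (G n)" for u
      proof -
        have "vweight (G n) u \<le> Max (vweight (G n) ` verts (G n))"
          using that finite_verts by (intro Max_ge) auto
        then have "rel_weight (G n) u \<le> Max (vweight (G n) ` verts (G n)) / total_weight (G n)"
          using total_weight_pos[OF Gn] by (simp add: divide_right_mono)
        then show ?thesis using elim(1) by simp
      qed
      have "(INF S\<in>?Q. partition_density q W S) < ?\<mu> + \<epsilon>" using \<epsilon> by (simp add: graphon_cut_density_eq)
      then obtain S where S: "S \<in> ?Q" "partition_density q W S < ?\<mu> + \<epsilon>"
        unfolding cINF_less_iff[OF unit_balanced_partitions_nonempty[OF q_pos c_le] bdd] by blast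
      obtain S' where S': "S' \<in> ?Q" "\<bar>partition_density q ?U S' - partition_density q W S\<bar> \<le> E * (\<epsilon> / E)"
        using close(1)[OF S(1)] by blast
      have meas: "S' i \<in> unit_measurable_sets" if "i \<in> {1..q}" for i
        using unit_balanced_partition_measurable[OF S'(1) that] .
      have mass: "c \<le> frac_mass (verts (G n)) (rel_weight (G n)) (occupancy (G n) S') i" if "i \<in> {1..q}" for i
        using frac_mass_occupancy[of "G n" S', OF Gn meas[OF that]] S'(1) that by (simp add: unit_balanced_partitions_def)
      obtain f where f: "f ` verts (G n) \<subseteq> {1..q}"
          "\<And>i. i \<in> {1..q} \<Longrightarrow> c \<le> frac_mass (verts (G n)) (rel_weight (G n)) (\<lambda>u. unit_row (f u)) i"
          "frac_density (verts (G n)) (rel_weight (G n)) (eweight (G n)) q (\<lambda>u. unit_row (f u))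
            \<le> frac_density (verts (G n)) (rel_weight (G n)) (eweight (G n)) q (occupancy (G n) S') + \<epsilon>"
        using round[OF vertex_weights_graph[OF Gn] p\<delta> stochastic_occupancy[OF Gn S'(1)] mass] by blast
      obtain V where V: "V \<in> ?B" "graph_density q (G n) V \<le> partition_density q ?U S' + \<epsilon>"
      proof (rule that)
        show "graph_density q (G n) (\<lambda>i\<in>{1..q}. {u \<in> verts (G n). f u = i}) \<le> partition_density q ?U S' + \<epsilon>"
          using f(3) labelling_balanced(2)[OF Gn c_pos f(1,2)] frac_density_occupancy[of "G n" q S', OF Gn meas]
          by simp
        show "(\<lambda>i\<in>{1..q}. {u \<in> verts (G n). f u = i}) \<in> ?B"
          by (rule labelling_balanced(1)[OF Gn c_pos f(1,2)])
      qed
      have "min_cut_density q c (G n) \<le> graph_density q (G n) V"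
        unfolding min_cut_density_eq using V(1) finite_balanced_partitions by (intro Min_le) auto
      then have upper: "min_cut_density q c (G n) < ?\<mu> + 3 * \<epsilon>"
        using V(2) S'(2) S(2) E by simp
      \<comment> \<open>The rounded partition \<open>V\<close> also shows that balanced partitions
        of this graph exist, so the minimum is attained and can be transferred back to the
        limit.\<close>
      have "min_cut_density q c (G n) \<in> graph_density q (G n) ` ?B"
        unfolding min_cut_density_eq using V(1) finite_balanced_partitions by (intro Min_in) auto
      then obtain V' where V': "V' \<in> ?B" "min_cut_density q c (G n) = graph_density q (G n) V'" by blast
      obtain T where T: "T \<in> ?Q"
          "\<bar>partition_density q ?U (\<lambda>i. \<Union>u\<in>V' i. step_interval (G n) u) - partition_density q W T\<bar> \<le> E * (\<epsilon> / E)"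
        using close(2)[OF step_partition(1)[OF Gn V'(1)]] by blast
      have "?\<mu> \<le> partition_density q W T"
        unfolding graphon_cut_density_eq using bdd T(1) by (rule cINF_lower)
      then have "?\<mu> \<le> min_cut_density q c (G n) + \<epsilon>"
        using T(2) V'(2) step_partition(2)[OF Gn V'(1)] E by simp
      then show ?case using upper \<epsilon> by (simp add: \<epsilon>_def abs_less_iff)
    qed
    then show "\<exists>no. \<forall>n\<ge>no. norm (min_cut_density q c (G n) - ?\<mu>) < r"
      by (simp add: eventually_sequentially)
  qed
qed

end
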